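(* Let $G$ be a $\Delta$-critical graph on $n$ vertices, where $\Delta=\Delta(G)$ is the maximum degree of $G$. If $\Delta\ge n/2$, then $G$ has a 2-factor.
   Context: All graphs are finite and simple. $\chi'(G)$ denotes the edge-chromatic index (the minimum number of colors in a proper edge coloring) of $G$, and $\Delta=\Delta(G)$ the maximum degree of $G$. A graph $G$ is called critical if it has no isolated vertices and $\chi'(G-e)<\chi'(G)$ for every edge $e\in E(G)$. A critical graph $G$ is called $\Delta$-critical if $\chi'(G)=\Delta(G)+1$. A 2-factor of $G$ is a 2-regular spanning subgraph of $G$. *)

theory Defs
  imports Complex_Main
begin

text \<open>
  A graph is given by its vertex set \<open>V\<close> and its edge set \<open>E\<close>, where an edge is the
  two-element set of its end vertices; thus there are no loops or parallel edges, and
  \<open>G - e\<close> is the graph \<open>V\<close>, \<open>E - {e}\<close>.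
\<close>

definition simple_graph :: "'a set \<Rightarrow> 'a set set \<Rightarrow> bool" where
  "simple_graph V E \<longleftrightarrow> finite V \<and> (\<forall>e\<in>E. e \<subseteq> V \<and> card e = 2)"

definition degree :: "'a set set \<Rightarrow> 'a \<Rightarrow> nat" where
  "degree E v = card {e \<in> E. v \<in> e}"

text \<open>The element \<open>0\<close> only fixes the value for the graph without vertices.\<close>

definition max_degree :: "'a set \<Rightarrow> 'a set set \<Rightarrow> nat" where
  "max_degree V E = Max (insert 0 (degree E ` V))"

definition proper_edge_coloring :: "'a set set \<Rightarrow> nat \<Rightarrow> ('a set \<Rightarrow> nat) \<Rightarrow> bool" where
  "proper_edge_coloring E k c \<longleftrightarrow>
     (\<forall>e\<in>E. c e < k) \<and> (\<forall>e\<in>E. \<forall>f\<in>E. e \<noteq> f \<and> e \<inter> f \<noteq> {} \<longrightarrow> c e \<noteq> c f)"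

definition chromatic_index :: "'a set set \<Rightarrow> nat" where
  "chromatic_index E = (LEAST k. \<exists>c. proper_edge_coloring E k c)"

definition critical_graph :: "'a set \<Rightarrow> 'a set set \<Rightarrow> bool" where
  "critical_graph V E \<longleftrightarrow> simple_graph V E \<and> (\<forall>v\<in>V. degree E v \<noteq> 0) \<and>
     (\<forall>e\<in>E. chromatic_index (E - {e}) < chromatic_index E)"

definition Delta_critical :: "'a set \<Rightarrow> 'a set set \<Rightarrow> bool" where
  "Delta_critical V E \<longleftrightarrow> critical_graph V E \<and> chromatic_index E = max_degree V E + 1"

text \<open>A spanning subgraph of \<open>(V, E)\<close> is \<open>(V, F)\<close> for some \<open>F \<subseteq> E\<close>.\<close>

definition two_factor :: "'a set \<Rightarrow> 'a set set \<Rightarrow> 'a set set \<Rightarrow> bool" where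
  "two_factor V E F \<longleftrightarrow> F \<subseteq> E \<and> (\<forall>v\<in>V. degree F v = 2)"

end

theory Submission
  imports Defs
begin

text \<open>
  If \<open>G\<close> has no 2-factor, Tutte's theorem gives disjoint sets \<open>S\<close>, \<open>T\<close> and components \<open>D\<close> of
  \<open>G - S - T\<close>, each joined to \<open>T\<close> by an odd number \<open>e(D)\<close> of edges. Minimising \<open>|T| - |S|\<close> makes \<open>T\<close>
  independent, with all its neighbours in \<open>S\<close> and the components, every vertex of a component with
  at most one neighbour in \<open>T\<close>, and \<open>2|T| \<ge> 2|S| + 2 + \<Sum>(e(D) - 1)\<close>.

  As \<open>|T| > |S|\<close> and \<open>n \<le> 2\<Delta>\<close>, comparing neighbourhoods shows that at most one vertex of \<open>T\<close> and at
  most one component \<open>D\<^sub>0\<close> have vertices of degree \<open>\<Delta>\<close>. Now every \<open>t\<close> in \<open>T\<close> sends \<open>1/d(t)\<close> to each of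
  its neighbours. If \<open>x\<close> lies in a component other than \<open>D\<^sub>0\<close> and is joined to \<open>t\<close>, Vizing's adjacency
  lemma gives \<open>x\<close> at least \<open>\<Delta> - d(t) + 1\<close> neighbours of degree \<open>\<Delta>\<close>, all in \<open>S\<close>; since
  \<open>d(\<Delta> - d + 1) \<ge> \<Delta>\<close>, it can pass on its charge in portions \<open>1/\<Delta>\<close> to them. By the adjacency lemma
  again no vertex of \<open>S\<close> ends up with more than 1. As \<open>D\<^sub>0\<close> receives at most \<open>e(D\<^sub>0)/2\<close>, this gives
  \<open>|T| \<le> |S| + e(D\<^sub>0)/2\<close>, contradicting the lower bound on \<open>|T|\<close>.
\<close>

section \<open>The Tutte-Berge formula\<close>

definition matching :: "'a set set \<Rightarrow> 'a set set \<Rightarrow> bool" where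
  "matching E M \<longleftrightarrow> M \<subseteq> E \<and> pairwise disjnt M"

definition maximum_matching :: "'a set set \<Rightarrow> 'a set set \<Rightarrow> bool" where
  "maximum_matching E M \<longleftrightarrow> matching E M \<and> (\<forall>N. matching E N \<longrightarrow> card N \<le> card M)"

text \<open>The members are unions of components of the graph without \<open>U\<close>, of odd
  order; they need not be connected, since all counts use only disjointness and closedness.\<close>

definition odd_family :: "'a set \<Rightarrow> 'a set set \<Rightarrow> 'a set \<Rightarrow> 'a set set \<Rightarrow> bool" where
  "odd_family V E U \<O> \<longleftrightarrow> pairwise disjnt \<O> \<and>
     (\<forall>C\<in>\<O>. C \<subseteq> V - U \<and> odd (card C) \<and> (\<forall>x\<in>C. \<forall>y. {x, y} \<in> E \<longrightarrow> y \<in> C \<union> U))"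

section \<open>Elementary facts about simple graphs and matchings\<close>

lemma simple_graph_finite:
  assumes "simple_graph V E"
  shows "finite V" "finite E"
proof -
  show "finite V" using assms by (simp add: simple_graph_def)
  then show "finite E"
    using assms by (auto simp: simple_graph_def intro: finite_subset[of E "Pow V"])
qed

lemma simple_graph_edge:
  assumes "simple_graph V E" "{x, y} \<in> E"
  shows "x \<noteq> y" "x \<in> V" "y \<in> V"
  using assms by (auto simp: simple_graph_def card_insert_if split: if_splits)

lemma simple_graph_edgeE:
  assumes "simple_graph V E" "e \<in> E" "x \<in> e"
  obtains y where "e = {x, y}" "x \<noteq> y"
proof -
  have "card e = 2" using assms by (auto simp: simple_graph_def)
  then obtain p q where "e = {p, q}" "p \<noteq> q" by (meson card_2_iff)
  then show thesis using that[of p] that[of q] assms(3) by (auto simp: insert_commute)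
qed

lemma matching_unique:
  assumes "matching E M" "e \<in> M" "f \<in> M" "x \<in> e" "x \<in> f"
  shows "e = f"
  using assms by (auto simp: matching_def pairwise_def disjnt_def)

lemma matching_cover:
  assumes "simple_graph V E" "matching E M"
  shows "\<Union>M \<subseteq> V" "finite M" "card (\<Union>M) = 2 * card M"
proof -
  have E: "\<And>e. e \<in> M \<Longrightarrow> e \<subseteq> V \<and> card e = 2"
    using assms by (auto simp: simple_graph_def matching_def)
  show "\<Union>M \<subseteq> V" using E by auto
  show "finite M"
    using assms simple_graph_finite(2) by (auto simp: matching_def intro: finite_subset)
  have "card (\<Union>M) = sum card M"
  proof (rule card_Union_disjoint)
    show "pairwise disjnt M" using assms(2) by (simp add: matching_def)
    show "\<And>A. A \<in> M \<Longrightarrow> finite A" using E by (metis card.infinite zero_neq_numeral)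
  qed
  also have "\<dots> = 2 * card M" using E by (simp add: sum.cong)
  finally show "card (\<Union>M) = 2 * card M" .
qed

lemma maximum_matching_exists:
  assumes "simple_graph V E"
  shows "\<exists>M. maximum_matching E M"
proof -
  have "finite E" using simple_graph_finite assms by blast
  moreover have "matching E {}" by (simp add: matching_def)
  ultimately have "\<exists>M. matching E M \<and> (\<forall>N. matching E N \<longrightarrow> card N \<le> card M)"
    using ex_has_greatest_nat[of "matching E" "{}" card "Suc (card E)"]
    by (metis card_mono le_imp_less_Suc matching_def)
  then show ?thesis by (simp add: maximum_matching_def)
qed

lemma maximum_matching_edge:
  assumes "simple_graph V E" "maximum_matching E M" "{x, y} \<in> E" "x \<notin> \<Union>M"
  shows "y \<in> \<Union>M"
proof (rule ccontr)
  assume y: "y \<notin> \<Union>M"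
  have "matching E (insert {x, y} M)"
    using assms y by (auto simp: maximum_matching_def matching_def pairwise_insert disjnt_def)
  moreover have "{x, y} \<notin> M" using y by auto
  moreover have "finite M"
    using matching_cover(2) assms(1,2) by (auto simp: maximum_matching_def)
  ultimately have "Suc (card M) \<le> card M" using assms(2)
    by (metis card_insert_disjoint maximum_matching_def)
  then show False by simp
qed

text \<open>
  The heart of Gallai's lemma: if all vertices are missed by some maximum matching, the relation
  ``equal or never missed together'' is transitive. Its classes will be the odd sets of the
  Tutte-Berge formula.
\<close>

lemma missed_together:
  assumes G: "simple_graph V E"
    and M: "maximum_matching E M" "u \<notin> \<Union>M" "v \<notin> \<Union>M" "u \<noteq> v"
    and ex: "\<exists>N. maximum_matching E N \<and> t \<notin> \<Union>N"
    and u: "\<And>N. maximum_matching E N \<Longrightarrow> t \<notin> \<Union>N \<Longrightarrow> u \<in> \<Union>N"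
    and v: "\<And>N. maximum_matching E N \<Longrightarrow> t \<notin> \<Union>N \<Longrightarrow> v \<in> \<Union>N"
  shows False
proof -
  have fM: "finite M" and cM: "card (\<Union>M) = 2 * card M" and sM: "\<Union>M \<subseteq> V"
    using matching_cover[OF G] M(1) by (simp_all add: maximum_matching_def)
  let ?P = "\<lambda>N. maximum_matching E N \<and> t \<notin> \<Union>N"
  obtain N0 where "?P N0" using ex by blast
  \<comment> \<open>Extremal choice: the exchange of \<open>f\<close> for \<open>e\<close> below
    yields a maximum matching that still misses \<open>t\<close> and shares one more edge with
    \<open>M\<close>.\<close>
  then obtain N where N: "?P N" and best: "\<And>N'. ?P N' \<Longrightarrow> card (M \<inter> N') \<le> card (M \<inter> N)"
    using ex_has_greatest_nat[of ?P N0 "\<lambda>N. card (M \<inter> N)" "Suc (card M)"]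
    by (metis card_mono fM inf_le1 le_imp_less_Suc)
  have fN: "finite N" and cN: "card (\<Union>N) = 2 * card N" and sN: "\<Union>N \<subseteq> V"
    using matching_cover[OF G] N by (simp_all add: maximum_matching_def)
  have fV: "finite V" using simple_graph_finite G by blast
  have "card M = card N"
    using M(1) N by (simp add: maximum_matching_def order_antisym)
  then have "card (\<Union>M - \<Union>N) = card (\<Union>N - \<Union>M)"
    using cM cN sM sN fV
    by (metis card_Diff_subset_Int diff_diff_left finite_Int finite_subset inf_commute)
  moreover have "card {u, v} \<le> card (\<Union>N - \<Union>M)"
    using u v N M sN fV by (intro card_mono) (auto intro: finite_subset)
  \<comment> \<open>\<open>M\<close> and \<open>N\<close> cover equally many vertices, and
    \<open>N\<close> covers \<open>u\<close> and \<open>v\<close>, which \<open>M\<close> misses. So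
    \<open>M\<close> covers at least two vertices missed by \<open>N\<close>, one of them different
    from \<open>t\<close>.\<close>
  ultimately have "\<not> \<Union>M - \<Union>N \<subseteq> {t}"
    using M(4) card_mono[of "{t}" "\<Union>M - \<Union>N"] by auto
  then obtain x where x: "x \<in> \<Union>M" "x \<notin> \<Union>N" "x \<noteq> t" by auto
  then obtain e where e: "e \<in> M" "x \<in> e" by auto
  have eE: "e \<in> E" using e M(1) by (auto simp: maximum_matching_def matching_def)
  obtain y where y: "e = {x, y}" using simple_graph_edgeE[OF G eE e(2)] by metis
  have "y \<in> \<Union>N" using maximum_matching_edge[OF G _ _ x(2)] N y eE by blast
  then obtain f where f: "f \<in> N" "y \<in> f" by auto
  have mM: "matching E M" and mN: "matching E N" using M(1) N by (auto simp: maximum_matching_def)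
  have fM': "f \<notin> M"
  proof
    assume "f \<in> M"
    then have "e = f" using matching_unique[OF mM e(1), of f y] f y by simp
    then show False using x(2) f(1) e(2) by blast
  qed
  define N' where "N' = insert e (N - {f})"
  have eN: "e \<notin> N" using x e by auto
  have "matching E N'"
  proof -
    have "disjnt e g" "disjnt g e" if "g \<in> N - {f}" for g
      using that matching_unique[OF mN f(1), of g y] f x(2) y by (auto simp: disjnt_def)
    moreover have "pairwise disjnt (N - {f})" using mN by (auto simp: matching_def pairwise_def)
    ultimately show ?thesis using mN eE
      unfolding N'_def matching_def by (auto simp: pairwise_insert)
  qed
  moreover have "card N' = card N" 
  proof -
    have "card N' = Suc (card (N - {f}))" using eN fN by (simp add: N'_def)
    then show ?thesis using card_Suc_Diff1[OF fN f(1)] by simp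
  qed
  ultimately have "maximum_matching E N'" using N by (simp add: maximum_matching_def)
  moreover have "t \<notin> \<Union>N'"
    using N x y \<open>y \<in> \<Union>N\<close> by (auto simp: N'_def)
  ultimately have "card (M \<inter> N') \<le> card (M \<inter> N)" using best by blast
  moreover have "M \<inter> N' = insert e (M \<inter> N)" using e fM' by (auto simp: N'_def)
  ultimately show False using eN fM by simp
qed

text \<open>Induction on the number of vertices. A vertex covered by every maximum matching is
  deleted and put into \<open>U\<close>. If there is none, \<open>U\<close> is empty, and the
  classes of the vertices missed by one maximum matching \<open>M\<close> serve as odd sets, one for
  each missed vertex.\<close>

lemma tutte_berge:
  assumes "simple_graph V E"
  shows "\<exists>M U \<O>. matching E M \<and> U \<subseteq> V \<and> odd_family V E U \<O> \<and> card V + card U \<le> 2 * card M + card \<O>"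
  using assms
proof (induction "card V" arbitrary: V E rule: less_induct)
  case less
  note G = less.prems
  have fV: "finite V" using simple_graph_finite G by blast
  obtain M where M: "maximum_matching E M" using maximum_matching_exists G by blast
  have m: "matching E M" using M by (simp add: maximum_matching_def)
  note mc = matching_cover[OF G m]
  show ?case
  proof (cases "\<exists>v\<in>V. \<forall>N. maximum_matching E N \<longrightarrow> v \<in> \<Union>N")
    case True
    then obtain v where v: "v \<in> V" "\<And>N. maximum_matching E N \<Longrightarrow> v \<in> \<Union>N" by blast
    let ?E = "{e \<in> E. v \<notin> e}"
    have G': "simple_graph (V - {v}) ?E" using G by (auto simp: simple_graph_def)
    have "card (V - {v}) < card V" using v(1) fV by (rule card_Diff1_less[rotated])
    from less.hyps[OF this G'] obtain N U \<O> where
      N: "matching ?E N" and U: "U \<subseteq> V - {v}" and O: "odd_family (V - {v}) ?E U \<O>"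
      and le: "card (V - {v}) + card U \<le> 2 * card N + card \<O>" by blast
    have mN: "matching E N" and vN: "v \<notin> \<Union>N" using N by (auto simp: matching_def)
    have "card N \<le> card M" using M mN by (simp add: maximum_matching_def)
    \<comment> \<open>\<open>N\<close> misses \<open>v\<close>, so it is not maximum. The gain of 2
      in \<open>2 * card M\<close> pays for counting \<open>v\<close> once in \<open>V\<close> and
      once in the enlarged \<open>U\<close>.\<close>
    moreover have "card N \<noteq> card M"
      using mN vN v(2) M by (metis maximum_matching_def)
    ultimately have "Suc (card N) \<le> card M" by simp
    moreover have "card (insert v U) = Suc (card U)"
      using U fV by (subst card_insert_disjoint) (auto intro: finite_subset)
    moreover have "card V = Suc (card (V - {v}))"
      using card_Suc_Diff1[OF fV v(1)] by simp
    ultimately have "card V + card (insert v U) \<le> 2 * card M + card \<O>" using le by simp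
    moreover have "odd_family V E (insert v U) \<O>"
      using O by (fastforce simp: odd_family_def)
    moreover have "insert v U \<subseteq> V" using U v by auto
    ultimately show ?thesis using m by blast
  next
    case False
    then have miss: "\<And>t. t \<in> V \<Longrightarrow> \<exists>N. maximum_matching E N \<and> t \<notin> \<Union>N" by blast
    define C where "C w = {x \<in> V. x = w \<or> (\<forall>N. maximum_matching E N \<longrightarrow> w \<notin> \<Union>N \<longrightarrow> x \<in> \<Union>N)}" for w
    define W where "W = V - \<Union>M"
    \<comment> \<open>Otherwise some maximum matching misses \<open>w\<close> and \<open>y\<close>
      together, whereas every one that misses \<open>x\<close> covers \<open>w\<close>, because
      \<open>x\<close> is in the class, and \<open>y\<close>, because of the edge.\<close>
    have closed: "y \<in> C w" if "x \<in> C w" "{x, y} \<in> E" "w \<in> W" for x y w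
    proof (rule ccontr)
      assume "y \<notin> C w"
      moreover have yx: "y \<in> V" "x \<in> V" using simple_graph_edge G that by metis+
      ultimately obtain N where N: "maximum_matching E N" "w \<notin> \<Union>N" "y \<notin> \<Union>N" "y \<noteq> w"
        by (auto simp: C_def)
      have "w \<in> \<Union>N'" if "maximum_matching E N'" "x \<notin> \<Union>N'" for N'
        using that \<open>x \<in> C w\<close> maximum_matching_edge[OF G N(1) \<open>{x,y} \<in> E\<close>] N by (auto simp: C_def)
      then show False
        using missed_together[OF G N(1) N(2) N(3) N(4)[symmetric] miss[OF yx(2)]]
          maximum_matching_edge[OF G _ \<open>{x,y} \<in> E\<close>] by blast
    qed
    have disj: "C w \<inter> C w' = {}" if "w \<in> W" "w' \<in> W" "w \<noteq> w'" for w w'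
    proof (rule ccontr)
      assume "C w \<inter> C w' \<noteq> {}"
      then obtain x where x: "x \<in> C w" "x \<in> C w'" by auto
      have xV: "x \<in> V" using x by (auto simp: C_def)
      have "w \<in> \<Union>N'" "w' \<in> \<Union>N'" if "maximum_matching E N'" "x \<notin> \<Union>N'" for N'
        using that x \<open>w \<noteq> w'\<close> \<open>w \<in> W\<close> \<open>w' \<in> W\<close> M by (auto simp: C_def W_def)
      then show False
        using missed_together[OF G M, of w w' x] miss[OF xV] that by (auto simp: W_def)
    qed
    \<comment> \<open>\<open>M\<close> misses \<open>w\<close> and hence no other vertex of
      \<open>C w\<close>; as the class is closed under adjacency, \<open>M\<close> pairs these other
      vertices among themselves.\<close>
    have odd: "odd (card (C w))" if w: "w \<in> W" for w
    proof -
      let ?M = "{e \<in> M. e \<subseteq> C w}"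
      have "C w = insert w (\<Union>?M)"
      proof
        show "insert w (\<Union>?M) \<subseteq> C w" using w by (auto simp: C_def W_def)
        show "C w \<subseteq> insert w (\<Union>?M)"
        proof
          fix x assume x: "x \<in> C w"
          show "x \<in> insert w (\<Union>?M)"
          proof (cases "x = w")
            case False
            then have "x \<in> \<Union>M" using x w M by (auto simp: C_def W_def)
            then obtain e where e: "e \<in> M" "x \<in> e" by auto
            have eE: "e \<in> E" using e m by (auto simp: matching_def)
            obtain y where "e = {x, y}" using simple_graph_edgeE[OF G eE e(2)] by metis
            then show ?thesis using closed[OF x _ w, of y] eE x e by auto
          qed simp
        qed
      qed
      moreover have "w \<notin> \<Union>?M" using w by (auto simp: W_def)
      moreover have mm: "matching E ?M" using m by (auto simp: matching_def pairwise_def)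
      moreover have "finite (\<Union>?M)" using matching_cover(1)[OF G mm] fV finite_subset by blast
      ultimately have "card (C w) = Suc (2 * card ?M)"
        using matching_cover(3)[OF G mm] by (metis card_insert_disjoint)
      then show ?thesis by simp
    qed
    have "odd_family V E {} (C ` W)"
      unfolding odd_family_def
    proof (intro conjI ballI allI impI)
      show "pairwise disjnt (C ` W)" unfolding pairwise_def disjnt_def using disj by blast
      fix A assume "A \<in> C ` W"
      then obtain w where w: "w \<in> W" "A = C w" by blast
      show "A \<subseteq> V - {}" using w by (auto simp: C_def)
      show "odd (card A)" using odd w by simp
      show "y \<in> A \<union> {}" if "x \<in> A" "{x, y} \<in> E" for x y using closed that w by blast
    qed
    moreover have "card (C ` W) = card W"
    proof (rule card_image, rule inj_onI)
      fix w w' assume a: "w \<in> W" "w' \<in> W" "C w = C w'"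
      have "w \<in> C w" using a by (auto simp: C_def W_def)
      then show "w = w'" using disj[OF a(1,2)] a(3) by auto
    qed
    moreover have "card W + 2 * card M = card V"
      using mc fV unfolding W_def by (metis card_Diff_subset card_mono finite_subset le_add_diff_inverse2)
    ultimately show ?thesis using m
      by (intro exI[of _ M] exI[of _ "{}"] exI[of _ "C ` W"]) auto
  qed
qed

text \<open>\<open>U\<close> is chosen smallest among the sets with fewer elements than odd sets. By
  parity the surplus can be taken to be at least 2. If \<open>u\<close> were joined to at most two
  odd sets, removing \<open>u\<close> from \<open>U\<close> and these sets from the family would
  leave a smaller such set.\<close>

lemma tutte_minimal:
  assumes G: "simple_graph V E" and even: "even (card V)"
    and no: "\<And>M. matching E M \<Longrightarrow> \<Union>M \<noteq> V"
  shows "\<exists>U \<O>. U \<subseteq> V \<and> odd_family V E U \<O> \<and> card U < card \<O> \<and>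
     (\<forall>u\<in>U. 3 \<le> card {C \<in> \<O>. \<exists>w\<in>C. {u, w} \<in> E})"
proof -
  have fV: "finite V" using simple_graph_finite G by blast
  let ?P = "\<lambda>U. U \<subseteq> V \<and> (\<exists>\<O>. odd_family V E U \<O> \<and> card U < card \<O>)"
  have "\<exists>U. ?P U"
  proof -
    obtain M U \<O> where M: "matching E M" "U \<subseteq> V" "odd_family V E U \<O>"
      "card V + card U \<le> 2 * card M + card \<O>" using tutte_berge[OF G] by blast
    have "card (\<Union>M) < card V"
      using no[OF M(1)] matching_cover(1)[OF G M(1)] fV by (intro psubset_card_mono) auto
    then have "card U < card \<O>" using M(4) matching_cover(3)[OF G M(1)] by linarith
    then show ?thesis using M(2,3) by blast
  qed
  then obtain U where U: "?P U" and min: "\<And>U'. ?P U' \<Longrightarrow> card U \<le> card U'"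
    using ex_has_least_nat[of ?P _ card] by metis
  then obtain \<O>0 where O0: "odd_family V E U \<O>0" "card U < card \<O>0" by blast
  have fU: "finite U" using U fV finite_subset by blast
  have fO: "finite \<O>" "\<And>C. C \<in> \<O> \<Longrightarrow> finite C" "card (\<Union>\<O>) = sum card \<O>"
    if "odd_family V E U \<O>" for \<O>
  proof -
    have "\<O> \<subseteq> Pow V" using that by (auto simp: odd_family_def)
    then show "finite \<O>" using fV by (simp add: finite_subset)
    show *: "\<And>C. C \<in> \<O> \<Longrightarrow> finite C" using that fV
      by (meson Diff_subset finite_subset odd_family_def)
    show "card (\<Union>\<O>) = sum card \<O>" using that *
      by (intro card_Union_disjoint) (auto simp: odd_family_def)
  qed
  \<comment> \<open>If the surplus is exactly 1, then \<open>card U + card \<O>0\<close> is odd; as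
    \<open>card V\<close> is even, the remaining vertices \<open>R\<close> are odd in number and
    form one more odd set.\<close>
  obtain \<O> where O: "odd_family V E U \<O>" "card U + 2 \<le> card \<O>"
  proof (cases "card \<O>0 = Suc (card U)")
    case True
    define R where "R = V - U - \<Union>\<O>0"
    have sub: "\<Union>\<O>0 \<subseteq> V - U" using O0 by (auto simp: odd_family_def)
    have "even (sum card \<O>0) = even (card \<O>0)"
    proof -
      have "{C \<in> \<O>0. odd (card C)} = \<O>0" using O0(1) by (auto simp: odd_family_def)
      then show ?thesis using fO(1)[OF O0(1)] by (simp add: even_sum_iff)
    qed
    then have "odd (card R)"
    proof -
      have "card V = card U + card (V - U)" using U fU fV
        by (metis card_Diff_subset card_mono le_add_diff_inverse)
      moreover have "card (V - U) = card (\<Union>\<O>0) + card R" unfolding R_def using sub fV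
        by (metis card_Diff_subset card_mono finite_Diff finite_subset le_add_diff_inverse)
      ultimately show ?thesis
        using even True \<open>even (sum card \<O>0) = even (card \<O>0)\<close> fO(3)[OF O0(1)]
        by (metis even_Suc even_add)
    qed
    moreover have "y \<in> R \<union> U" if x: "x \<in> R" and xy: "{x, y} \<in> E" for x y
    proof (rule ccontr)
      assume "y \<notin> R \<union> U"
      then obtain C where "C \<in> \<O>0" "y \<in> C" using simple_graph_edge[OF G xy] by (auto simp: R_def)
      moreover have "{y, x} \<in> E" using xy by (simp add: insert_commute)
      ultimately have "x \<in> C \<union> U" using O0(1) unfolding odd_family_def by blast
      then show False using x \<open>C \<in> \<O>0\<close> by (auto simp: R_def)
    qed
    moreover have "disjnt R C" if "C \<in> \<O>0" for C using that by (auto simp: R_def disjnt_def)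
    moreover have "R \<subseteq> V - U" by (auto simp: R_def)
    ultimately have "odd_family V E U (insert R \<O>0)"
      using O0 by (auto simp: odd_family_def pairwise_insert disjnt_sym)
    moreover have "R \<notin> \<O>0" using \<open>odd (card R)\<close> by (auto simp: R_def dest: odd_card_imp_not_empty)
    ultimately show thesis using that[of "insert R \<O>0"] fO(1)[OF O0(1)] True by simp
  next
    case False
    then show thesis using that O0 by simp
  qed
  have "3 \<le> card {C \<in> \<O>. \<exists>w\<in>C. {u, w} \<in> E}" if u: "u \<in> U" for u
  proof (rule ccontr)
    assume few: "\<not> ?thesis"
    define B where "B = {C \<in> \<O>. \<exists>w\<in>C. {u, w} \<in> E}"
    have B2: "card B \<le> 2" using few by (simp add: B_def)
    have "card (\<O> - B) = card \<O> - card B"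
      using fO(1)[OF O(1)] by (intro card_Diff_subset) (auto simp: B_def)
    moreover have "card U = Suc (card (U - {u}))" using card_Suc_Diff1[OF fU u] by simp
    ultimately have "card (U - {u}) < card (\<O> - B)" using O(2) B2 by linarith
    moreover have "odd_family V E (U - {u}) (\<O> - B)"
      unfolding odd_family_def
    proof (intro conjI ballI allI impI)
      show "pairwise disjnt (\<O> - B)" using O by (auto simp: odd_family_def pairwise_def)
      fix C assume C: "C \<in> \<O> - B"
      then show "C \<subseteq> V - (U - {u})" "odd (card C)" using O by (auto simp: odd_family_def)
      fix x y assume xy: "x \<in> C" "{x, y} \<in> E"
      then have "y \<in> C \<union> U" using C O unfolding odd_family_def by blast
      moreover have "y \<noteq> u" using C xy by (auto simp: B_def insert_commute)
      ultimately show "y \<in> C \<union> (U - {u})" by auto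
    qed
    ultimately have "card U \<le> card (U - {u})" using min U by blast
    then show False using card_Diff1_less[OF fU u] by simp
  qed
  then show ?thesis using U O by (intro exI[of _ U] exI[of _ \<O>]) auto
qed

section \<open>Barriers for 2-factors\<close>

text \<open>With ordered pairs an edge inside a set counts twice, so for disjoint \<open>S\<close>
  and \<open>T\<close> the number \<open>card (arcs E T (V - S))\<close> in a barrier is the degree
  sum over \<open>T\<close> in the graph without \<open>S\<close>.\<close>

definition arcs :: "'a set set \<Rightarrow> 'a set \<Rightarrow> 'a set \<Rightarrow> ('a \<times> 'a) set" where
  "arcs E A B = {(a, b). a \<in> A \<and> b \<in> B \<and> {a, b} \<in> E}"

text \<open>
  In place of the odd components of \<open>G - S - T\<close>, a barrier contains any family \<open>\<D>\<close> of disjoint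
  unions of components with oddly many edges to \<open>T\<close>.
\<close>

definition barrier :: "'a set \<Rightarrow> 'a set set \<Rightarrow> 'a set \<Rightarrow> 'a set \<Rightarrow> 'a set set \<Rightarrow> bool" where
  "barrier V E S T \<D> \<longleftrightarrow> S \<subseteq> V \<and> T \<subseteq> V \<and> S \<inter> T = {} \<and> pairwise disjnt \<D> \<and>
     (\<forall>D\<in>\<D>. D \<subseteq> V - S - T \<and> odd (card (arcs E D T)) \<and>
        (\<forall>x\<in>D. \<forall>y. {x, y} \<in> E \<longrightarrow> y \<in> D \<union> S \<union> T)) \<and>
     2 * card S + card (arcs E T (V - S)) < 2 * card T + card \<D>"

text \<open>
  \<open>Half v u\<close> is the half of the edge \<open>{v, u}\<close> at \<open>v\<close>. A perfect matching joins the two copies of each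
  vertex to two of its half-edges, and the halves of the edges that are not used to each other.
\<close>

datatype 'a gadget = Copy 'a bool | Half 'a 'a

definition gadget_vertices :: "'a set \<Rightarrow> 'a set set \<Rightarrow> 'a gadget set" where
  "gadget_vertices V E = {Copy v i |v i. v \<in> V} \<union> {Half v u |v u. {v, u} \<in> E}"

definition gadget_edges :: "'a set set \<Rightarrow> 'a gadget set set" where
  "gadget_edges E = {{Copy v i, Half v u} |v i u. {v, u} \<in> E} \<union> {{Half v u, Half u v} |v u. {v, u} \<in> E}"

section \<open>Parity and counting of edges between vertex sets\<close>

lemma even_card_involution:
  assumes "finite A" "\<And>x. x \<in> A \<Longrightarrow> f x \<in> A \<and> f (f x) = x \<and> f x \<noteq> x"
  shows "even (card A)"
  using assms
proof (induction "card A" arbitrary: A rule: less_induct)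
  case less
  show ?case
  proof (cases "A = {}")
    case False
    then obtain x where x: "x \<in> A" by auto
    have "card (A - {x, f x}) < card A" using x less.prems(1) by (intro psubset_card_mono) auto
    moreover have "f y \<in> A - {x, f x} \<and> f (f y) = y \<and> f y \<noteq> y" if "y \<in> A - {x, f x}" for y
      using that less.prems(2)[of y] less.prems(2)[of x] x by auto
    ultimately have "even (card (A - {x, f x}))"
      using less.hyps less.prems(1) by blast
    moreover have "card (A - {x, f x}) = card A - 2" "2 \<le> card A"
      using less.prems(1) less.prems(2)[OF x] x card_mono[of A "{x, f x}"]
      by (auto simp: card_Diff_subset)
    ultimately show ?thesis by simp
  qed simp
qed

lemma finite_arcs [simp]:
  assumes "finite A" "finite B"
  shows "finite (arcs E A B)"
  by (rule finite_subset[of _ "A \<times> B"]) (use assms in \<open>auto simp: arcs_def\<close>)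

lemma card_arcs_commute: "card (arcs E A B) = card (arcs E B A)"
proof -
  have "arcs E B A = prod.swap ` arcs E A B"
    by (auto simp: arcs_def image_iff insert_commute)
  then show ?thesis by (simp add: card_image)
qed

lemma card_arcs_Un:
  assumes "finite A" "finite B" "finite C" "B \<inter> C = {}"
  shows "card (arcs E A (B \<union> C)) = card (arcs E A B) + card (arcs E A C)"
proof -
  have "arcs E A (B \<union> C) = arcs E A B \<union> arcs E A C" by (auto simp: arcs_def)
  moreover have "arcs E A B \<inter> arcs E A C = {}" using assms(4) by (auto simp: arcs_def)
  ultimately show ?thesis using assms by (simp add: card_Un_disjoint)
qed

lemma even_card_arcs:
  assumes "simple_graph V E" "A \<subseteq> V"
  shows "even (card (arcs E A A))"
proof (rule even_card_involution[of _ prod.swap])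
  show "finite (arcs E A A)"
    using assms simple_graph_finite(1) finite_subset by (metis finite_arcs)
qed (use assms simple_graph_edge(1)[OF assms(1)] in \<open>auto simp: arcs_def insert_commute\<close>)

lemma card_disjoint_family_le:
  assumes "finite Z" "pairwise disjnt \<O>" "\<And>C. C \<in> \<O> \<Longrightarrow> C \<inter> Z \<noteq> {}"
  shows "card \<O> \<le> card Z"
proof -
  obtain g where g: "\<And>C. C \<in> \<O> \<Longrightarrow> g C \<in> C \<inter> Z" using assms(3) by (meson ex_in_conv)
  have "inj_on g \<O>"
  proof (rule inj_onI)
    fix C C' assume C: "C \<in> \<O>" "C' \<in> \<O>" "g C = g C'"
    then have "g C \<in> C \<inter> C'" using g[of C] g[of C'] by simp
    then show "C = C'" using pairwiseD[OF assms(2) C(1,2)] by (auto simp: disjnt_def)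
  qed
  moreover have "g ` \<O> \<subseteq> Z" using g by auto
  ultimately show ?thesis using assms(1) card_inj_on_le by blast
qed

section \<open>Perfect matchings of the gadget graph and 2-factors\<close>

context
  fixes V :: "'a set" and E :: "'a set set"
  assumes G: "simple_graph V E"
begin

lemma gadget_edge_Copy: "{Copy v i, y} \<in> gadget_edges E \<longleftrightarrow> (\<exists>u. y = Half v u \<and> {v, u} \<in> E)"
  by (auto simp: gadget_edges_def doubleton_eq_iff)

lemma gadget_edge_Half:
  "{Half v u, y} \<in> gadget_edges E \<longleftrightarrow> {v, u} \<in> E \<and> (y = Half u v \<or> (\<exists>i. y = Copy v i))"
  by (auto simp: gadget_edges_def doubleton_eq_iff insert_commute)

lemma simple_graph_gadget: "simple_graph (gadget_vertices V E) (gadget_edges E)"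
proof -
  have "gadget_vertices V E \<subseteq> (\<lambda>(v, i). Copy v i) ` (V \<times> UNIV) \<union> (\<lambda>(v, u). Half v u) ` (V \<times> V)"
    using simple_graph_edge[OF G] by (auto simp: gadget_vertices_def)
  moreover have "finite V" using G simple_graph_finite by blast
  ultimately have "finite (gadget_vertices V E)"
    by (metis finite_SigmaI finite_UnI finite_code finite_imageI finite_subset)
  moreover have "e \<subseteq> gadget_vertices V E \<and> card e = 2" if "e \<in> gadget_edges E" for e
    using that simple_graph_edge[OF G]
    by (auto simp: gadget_edges_def gadget_vertices_def insert_commute card_insert_if)
  ultimately show ?thesis by (simp add: simple_graph_def)
qed

text \<open>This involution has no fixed point on the gadget vertices, as there are no loops. It
  gives the parity of the whole gadget graph and later that of the odd sets.\<close>

fun gadget_flip :: "'a gadget \<Rightarrow> 'a gadget" where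
  "gadget_flip (Copy v i) = Copy v (\<not> i)"
| "gadget_flip (Half v u) = Half u v"

lemma even_card_gadget: "even (card (gadget_vertices V E))"
proof (rule even_card_involution[of _ gadget_flip])
  show "finite (gadget_vertices V E)" using simple_graph_gadget simple_graph_finite by blast
qed (use simple_graph_edge[OF G] in \<open>auto simp: gadget_vertices_def insert_commute\<close>)

text \<open>A perfect matching joins a half either to the opposite half or to a copy of its own end.
  The edges whose halves are of the second kind give each vertex degree 2, one edge for each
  copy.\<close>

lemma two_factor_of_gadget_matching:
  assumes M: "matching (gadget_edges E) M" "\<Union>M = gadget_vertices V E"
  shows "\<exists>F. two_factor V E F"
proof -
  define F where "F = {{v, u} |v u. {v, u} \<in> E \<and> {Half v u, Half u v} \<notin> M}"
  have ME: "M \<subseteq> gadget_edges E" using M by (simp add: matching_def)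
  have uniq: "p = q" if "{x, p} \<in> M" "{x, q} \<in> M" for x p q
  proof -
    have "{x, p} = {x, q}" using matching_unique[OF M(1) that, of x] by simp
    then show ?thesis by (auto simp: doubleton_eq_iff)
  qed
  have partner: "\<exists>p. {x, p} \<in> M" if x: "x \<in> gadget_vertices V E" for x
  proof -
    obtain e where "e \<in> M" "x \<in> e" using M(2) x by auto
    then show ?thesis using simple_graph_edgeE[OF simple_graph_gadget, of e x] ME by (metis subsetD)
  qed
  have "degree F v = 2" if v: "v \<in> V" for v
  proof -
    have "\<exists>u. {Copy v i, Half v u} \<in> M \<and> {v, u} \<in> E" for i
      using partner[of "Copy v i"] v ME gadget_edge_Copy by (fastforce simp: gadget_vertices_def)
    then obtain h where h: "\<And>i. {Copy v i, Half v (h i)} \<in> M" "\<And>i. {v, h i} \<in> E" by metis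
    have "h True \<noteq> h False"
      using uniq[of "Half v (h True)" "Copy v True" "Copy v False"] h(1)
      by (metis gadget.inject(1) insert_commute)
    moreover have "{e \<in> F. v \<in> e} = {{v, h True}, {v, h False}}"
    proof
      show "{e \<in> F. v \<in> e} \<subseteq> {{v, h True}, {v, h False}}"
      proof
        fix e assume "e \<in> {e \<in> F. v \<in> e}"
        then obtain a b where ab: "e = {a, b}" "{a, b} \<in> E" "{Half a b, Half b a} \<notin> M" "v = a \<or> v = b"
          unfolding F_def by auto
        define u where "u = (if v = a then b else a)"
        have u: "e = {v, u}" "{v, u} \<in> E" "{Half v u, Half u v} \<notin> M"
          using ab unfolding u_def by (auto simp: insert_commute)
        obtain p where p: "{Half v u, p} \<in> M" using partner[of "Half v u"] u
          by (auto simp: gadget_vertices_def)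
        moreover have "p = Half u v \<or> (\<exists>i. p = Copy v i)"
          using p ME gadget_edge_Half[of v u p] by blast
        ultimately obtain i where "p = Copy v i" using u by blast
        then have "u = h i" using uniq[of "Copy v i" "Half v u" "Half v (h i)"] p h(1)[of i]
          by (simp add: insert_commute)
        then show "e \<in> {{v, h True}, {v, h False}}" using u by (cases i) auto
      qed
      have "{Half v (h i), Half (h i) v} \<notin> M" for i
        using uniq[of "Half v (h i)" "Copy v i" "Half (h i) v"] h(1)[of i]
        by (auto simp: insert_commute)
      then show "{{v, h True}, {v, h False}} \<subseteq> {e \<in> F. v \<in> e}"
        using h(2) by (auto simp: F_def)
    qed
    ultimately show ?thesis by (simp add: degree_def doubleton_eq_iff)
  qed
  moreover have "F \<subseteq> E" by (auto simp: F_def)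
  ultimately show ?thesis by (auto simp: two_factor_def)
qed

text \<open>Assumption \<open>three\<close> fixes the shape of \<open>U\<close>: both copies of each
  vertex of \<open>S\<close>, all halves at vertices of \<open>T\<close>, and nothing else. The odd
  sets that avoid \<open>Z\<close> induce the members of the barrier; the others number at most
  \<open>card Z\<close>. Inserting the sizes of \<open>U\<close> and \<open>Z\<close> into
  \<open>card U < card \<O>\<close> gives the barrier inequality.\<close>

lemma barrier_of_gadget:
  assumes U: "U \<subseteq> gadget_vertices V E" and O: "odd_family (gadget_vertices V E) (gadget_edges E) U \<O>"
    and less: "card U < card \<O>"
    and three: "\<And>u. u \<in> U \<Longrightarrow> 3 \<le> card {C \<in> \<O>. \<exists>w\<in>C. {u, w} \<in> gadget_edges E}"
  shows "\<exists>S T \<D>. barrier V E S T \<D>"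
proof -
  let ?E = "gadget_edges E"
  let ?V = "gadget_vertices V E"
  have fV: "finite V" and fV': "finite ?V"
    using G simple_graph_gadget simple_graph_finite by blast+
  have fO: "finite \<O>" using less card.infinite by fastforce
  have disj: "C = C'" if "C \<in> \<O>" "C' \<in> \<O>" "x \<in> C" "x \<in> C'" for C C' x
    using that O by (auto simp: odd_family_def pairwise_def disjnt_def)
  have closed: "y \<in> C \<or> y \<in> U" if "C \<in> \<O>" "x \<in> C" "{x, y} \<in> ?E" for C x y
    using that O unfolding odd_family_def by blast
  have CV: "x \<in> ?V" "x \<notin> U" if "C \<in> \<O>" "x \<in> C" for C x using that O unfolding odd_family_def by auto
  \<comment> \<open>Both copies of \<open>v\<close> have the same neighbours. If only one were in
    \<open>U\<close>, every odd set joined to it would contain the other, so there would be at most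
    one such set instead of three.\<close>
  have copies: "Copy v j \<in> U" if vi: "Copy v i \<in> U" for v i j
  proof (rule ccontr)
    assume j: "Copy v j \<notin> U"
    let ?B = "{C \<in> \<O>. \<exists>w\<in>C. {Copy v i, w} \<in> ?E}"
    have "Copy v j \<in> C" if C: "C \<in> ?B" for C
    proof -
      obtain w where w: "w \<in> C" "{Copy v i, w} \<in> ?E" using C by auto
      then have "{w, Copy v j} \<in> ?E" by (auto simp: gadget_edge_Copy gadget_edge_Half)
      then show ?thesis using closed[of C w] w that j by auto
    qed
    then have "?B \<subseteq> {C}" if "C \<in> ?B" for C using that disj by blast
    moreover have "?B \<noteq> {}"
    proof
      assume "?B = {}"
      then have "card ?B = 0" by (simp only: card.empty)
      then show False using three[OF vi] by linarith
    qed
    ultimately obtain C where "?B \<subseteq> {C}" by blast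
    then have "card ?B \<le> card {C}" by (intro card_mono) auto
    then show False using three[OF vi] by simp
  qed
  \<comment> \<open>A half has only three neighbours, the two copies of its end and the opposite
    half, so these lie in three different odd sets. Any half at \<open>v\<close> outside
    \<open>U\<close> would belong to the sets of both copies at once.\<close>
  have halves: "Copy v i \<notin> U \<and> Half u v \<notin> U \<and> (\<forall>w. {v, w} \<in> E \<longrightarrow> Half v w \<in> U)"
    if vu: "Half v u \<in> U" for v u i
  proof -
    let ?B = "{C \<in> \<O>. \<exists>w\<in>C. {Half v u, w} \<in> ?E}"
    let ?N = "{Copy v True, Copy v False, Half u v}"
    have meet: "\<exists>w. w \<in> ?N \<and> w \<in> C" if C: "C \<in> ?B" for C
    proof -
      obtain w where w: "w \<in> C" "{Half v u, w} \<in> ?E" using C by auto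
      then have "w \<in> ?N" using gadget_edge_Half[of v u w] by (metis (full_types) insertCI)
      then show ?thesis using w(1) by blast
    qed
    define g where "g C = (SOME w. w \<in> ?N \<and> w \<in> C)" for C
    have g: "g C \<in> ?N \<and> g C \<in> C" if "C \<in> ?B" for C
      unfolding g_def by (rule someI_ex) (rule meet[OF that])
    have inj: "inj_on g ?B"
    proof (rule inj_onI)
      fix C C' assume "C \<in> ?B" "C' \<in> ?B" "g C = g C'"
      then show "C = C'" using g[of C] g[of C'] disj[of C C' "g C"] by simp
    qed
    have "card ?N \<le> card (g ` ?B)"
      using three[OF vu] by (simp add: card_image[OF inj] card_insert_if)
    moreover have "g ` ?B \<subseteq> ?N" using g by (intro image_subsetI) simp
    ultimately have img: "g ` ?B = ?N" by (intro card_seteq) simp_all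
    have mem: "\<exists>C\<in>?B. x \<in> C \<and> g C = x" if "x \<in> ?N" for x
    proof -
      have "x \<in> g ` ?B" using that unfolding img .
      then obtain C where C: "C \<in> ?B" "x = g C" by (rule imageE)
      then show ?thesis using g[OF C(1)] by (intro bexI[OF _ C(1)]) simp
    qed
    obtain C1 where C1: "C1 \<in> ?B" "Copy v True \<in> C1" "g C1 = Copy v True" using mem[of "Copy v True"] by auto
    obtain C2 where C2: "C2 \<in> ?B" "Copy v False \<in> C2" "g C2 = Copy v False" using mem[of "Copy v False"] by auto
    obtain C3 where C3: "C3 \<in> ?B" "Half u v \<in> C3" using mem[of "Half u v"] by auto
    have "Half v w \<in> U" if "{v, w} \<in> E" for w
    proof (rule ccontr)
      assume "Half v w \<notin> U"
      then have "Half v w \<in> C1" "Half v w \<in> C2"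
        using closed[of C1 "Copy v True" "Half v w"] closed[of C2 "Copy v False" "Half v w"] C1 C2 that
        by (auto simp: gadget_edge_Copy)
      then show False using disj[of C1 C2 "Half v w"] C1 C2 by auto
    qed
    moreover have "Copy v i \<notin> U" using CV(2)[of C1] CV(2)[of C2] C1 C2 by (cases i) auto
    moreover have "Half u v \<notin> U" using CV(2)[of C3] C3 by auto
    ultimately show ?thesis by blast
  qed
  define S where "S = {v \<in> V. Copy v True \<in> U}"
  define T where "T = {v \<in> V. Copy v True \<notin> U \<and> (\<forall>u. {v, u} \<in> E \<longrightarrow> Half v u \<in> U)}"
  have inS: "Copy v i \<in> U \<longleftrightarrow> v \<in> S" for v i
    using U copies[of v] by (auto simp: S_def gadget_vertices_def)
  have inT: "Half v u \<in> U \<longleftrightarrow> {v, u} \<in> E \<and> v \<in> T" for v u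
    using U halves[of v u] simple_graph_edge[OF G] by (fastforce simp: T_def gadget_vertices_def)
  have ST: "S \<subseteq> V" "T \<subseteq> V" "S \<inter> T = {}" by (auto simp: S_def T_def)
  then have fST: "finite S" "finite T" using fV by (auto intro: finite_subset)
  \<comment> \<open>These are the gadget vertices that become isolated when \<open>U\<close> is
    removed because of \<open>T\<close>: copies of its vertices, and halves at \<open>S\<close>
    whose opposite half is at \<open>T\<close>.\<close>
  define Z where "Z = (\<lambda>(v, i). Copy v i) ` (T \<times> UNIV) \<union> (\<lambda>(v, u). Half v u) ` arcs E S T"
  define D where "D C = {v \<in> V - S - T. Copy v True \<in> C}" for C
  define \<O>1 where "\<O>1 = {C \<in> \<O>. C \<inter> Z \<noteq> {}}"
  define \<O>2 where "\<O>2 = \<O> - \<O>1"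
  have cZ: "card Z = 2 * card T + card (arcs E S T)"
  proof -
    have "card Z = card ((\<lambda>(v, i). Copy v i) ` (T \<times> (UNIV :: bool set))) + card ((\<lambda>(v, u). Half v u) ` arcs E S T)"
      unfolding Z_def using fST by (intro card_Un_disjoint) auto
    then show ?thesis by (simp add: card_image inj_on_def card_cartesian_product split: prod.splits)
  qed
  have fZ: "finite Z" using fST by (simp add: Z_def)
  have cU: "card U = 2 * card S + card (arcs E T V)"
  proof -
    have "U = (\<lambda>(v, i). Copy v i) ` (S \<times> UNIV) \<union> (\<lambda>(v, u). Half v u) ` arcs E T V"
    proof (intro set_eqI)
      fix x show "x \<in> U \<longleftrightarrow> x \<in> (\<lambda>(v, i). Copy v i) ` (S \<times> UNIV) \<union> (\<lambda>(v, u). Half v u) ` arcs E T V"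
        using inS inT simple_graph_edge[OF G] by (cases x) (auto simp: arcs_def image_iff)
    qed
    then have "card U = card ((\<lambda>(v, i). Copy v i) ` (S \<times> (UNIV :: bool set))) + card ((\<lambda>(v, u). Half v u) ` arcs E T V)"
      using fST fV by (simp only:) (intro card_Un_disjoint, auto)
    then show ?thesis by (simp add: card_image inj_on_def card_cartesian_product split: prod.splits)
  qed
  have half_in: "Half v u \<in> C \<longleftrightarrow> v \<in> D C" if "C \<in> \<O>" "v \<notin> S" "v \<notin> T" "{v, u} \<in> E" for C v u
  proof -
    have "v \<in> V" using simple_graph_edge[OF G] that by auto
    then show ?thesis using that closed[of C "Half v u" "Copy v True"] closed[of C "Copy v True" "Half v u"] inS inT
      by (auto simp: gadget_edge_Copy gadget_edge_Half D_def)
  qed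
  have odd: "odd (card (arcs E (D C) T))" if C: "C \<in> \<O>2" for C
  proof -
    have CO: "C \<in> \<O>" and CZ: "C \<inter> Z = {}" using C by (auto simp: \<O>2_def \<O>1_def)
    have noT: "v \<notin> T \<and> v \<notin> S" if "Copy v i \<in> C" for v i
      using that CZ CV[OF CO that] inS by (auto simp: Z_def image_iff)
    have noST: "v \<notin> T" "v \<in> S \<Longrightarrow> u \<notin> T" "{v, u} \<in> E" if "Half v u \<in> C" for v u
    proof -
      show vu: "{v, u} \<in> E" using CV[OF CO that] by (auto simp: gadget_vertices_def)
      then show "v \<notin> T" using CV[OF CO that] inT by auto
      show "v \<in> S \<Longrightarrow> u \<notin> T" using that CZ vu by (auto simp: Z_def image_iff arcs_def)
    qed
    have fC: "finite C" using CV(1)[OF CO] fV' by (meson finite_subset subsetI)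
    define A where "A = (\<lambda>(v, u). Half v u) ` arcs E (D C) T"
    have AC: "A \<subseteq> C" using half_in[OF CO] by (auto simp: A_def arcs_def D_def)
    have cA: "card A = card (arcs E (D C) T)"
      unfolding A_def by (rule card_image) (auto simp: inj_on_def)
    \<comment> \<open>The flip pairs off the rest of \<open>C\<close>. The two copies of a vertex
      are linked through a half outside \<open>U\<close>, and the opposite of a half in
      \<open>C\<close> lies outside \<open>C\<close> only if it is at \<open>T\<close>, in which
      case the half belongs to \<open>A\<close>.\<close>
    have "even (card (C - A))"
    proof (rule even_card_involution[of _ gadget_flip])
      fix x assume x: "x \<in> C - A"
      show "gadget_flip x \<in> C - A \<and> gadget_flip (gadget_flip x) = x \<and> gadget_flip x \<noteq> x"
      proof (cases x)
        case (Copy v i)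
        then have v: "v \<notin> T" "v \<notin> S" "v \<in> V" using noT x CV[OF CO] by (auto simp: gadget_vertices_def)
        then obtain u where u: "{v, u} \<in> E" "Half v u \<notin> U" using inS by (auto simp: T_def)
        then have "Half v u \<in> C" using closed[OF CO, of x "Half v u"] x Copy by (auto simp: gadget_edge_Copy)
        then have "Copy v (\<not> i) \<in> C" using closed[OF CO, of "Half v u" "Copy v (\<not> i)"] u v inS
          by (auto simp: gadget_edge_Half)
        then show ?thesis using Copy by (auto simp: A_def)
      next
        case (Half v u)
        then have vu: "{v, u} \<in> E" "v \<notin> T" "v \<in> S \<Longrightarrow> u \<notin> T" using noST[of v u] x by auto
        have "u \<notin> T"
        proof
          assume "u \<in> T"
          then have "v \<in> D C" using half_in[OF CO _ vu(2) vu(1)] vu(3) x Half by auto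
          then show False using x Half vu \<open>u \<in> T\<close> by (auto simp: A_def arcs_def image_iff)
        qed
        then have "Half u v \<in> C" using closed[OF CO, of x "Half u v"] x Half vu inT
          by (auto simp: gadget_edge_Half)
        moreover have "Half u v \<notin> A" using vu by (auto simp: A_def arcs_def)
        moreover have "u \<noteq> v" using vu simple_graph_edge[OF G] by auto
        ultimately show ?thesis using Half by auto
      qed
    qed (use fC in auto)
    moreover have "card C = card A + card (C - A)"
      using AC fC by (metis card_Diff_subset card_mono finite_subset le_add_diff_inverse)
    moreover have "odd (card C)" using CO O by (auto simp: odd_family_def)
    ultimately show ?thesis using cA by simp
  qed
  have Ddisj: "D C \<inter> D C' = {}" if "C \<in> \<O>" "C' \<in> \<O>" "C \<noteq> C'" for C C'
    using disj[OF that(1,2)] that(3) by (auto simp: D_def)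
  have inj: "inj_on D \<O>2"
  proof (rule inj_onI)
    fix C C' assume a: "C \<in> \<O>2" "C' \<in> \<O>2" "D C = D C'"
    have "D C \<noteq> {}" using odd[OF a(1)] by (auto simp: arcs_def)
    then show "C = C'" using a Ddisj[of C C'] by (auto simp: \<O>2_def)
  qed
  have "card \<O>1 \<le> card Z"
    using fZ O by (intro card_disjoint_family_le) (auto simp: \<O>1_def odd_family_def pairwise_def)
  moreover have "card \<O> = card \<O>1 + card \<O>2"
    unfolding \<O>2_def using fO
    by (metis (no_types, lifting) \<O>1_def card_Diff_subset card_mono finite_subset le_add_diff_inverse mem_Collect_eq subsetI)
  ultimately have "2 * card S + card (arcs E T V) < 2 * card T + card (arcs E S T) + card (D ` \<O>2)"
    using less cZ cU card_image[OF inj] by simp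
  moreover have "V - S \<union> S = V" using ST by auto
  then have "card (arcs E T V) = card (arcs E T (V - S)) + card (arcs E S T)"
    using card_arcs_Un[of T "V - S" S E] fV fST card_arcs_commute[of E T S]
    by (metis Diff_disjoint finite_Diff inf_commute)
  ultimately have "2 * card S + card (arcs E T (V - S)) < 2 * card T + card (D ` \<O>2)" by simp
  moreover have "pairwise disjnt (D ` \<O>2)"
    using Ddisj by (auto simp: pairwise_def disjnt_def \<O>2_def)
  moreover have "y \<in> D C \<union> S \<union> T" if "C \<in> \<O>2" "x \<in> D C" "{x, y} \<in> E" for C x y
  proof (rule ccontr)
    assume y: "y \<notin> D C \<union> S \<union> T"
    have CO: "C \<in> \<O>" using that by (auto simp: \<O>2_def)
    have x: "x \<notin> S" "x \<notin> T" using that by (auto simp: D_def)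
    have "Half x y \<in> C" using half_in[OF CO x that(3)] that(2) by simp
    then have "Half y x \<in> C" using closed[OF CO, of "Half x y" "Half y x"] y inT that(3)
      by (auto simp: gadget_edge_Half)
    then show False using half_in[OF CO, of y x] y that(3) by (simp add: insert_commute)
  qed
  ultimately have "barrier V E S T (D ` \<O>2)"
    using ST odd unfolding barrier_def by (auto simp: D_def)
  then show ?thesis by blast
qed

lemma two_factor_or_barrier:
  assumes "\<nexists>F. two_factor V E F"
  shows "\<exists>S T \<D>. barrier V E S T \<D>"
proof -
  have "\<Union>M \<noteq> gadget_vertices V E" if "matching (gadget_edges E) M" for M
    using two_factor_of_gadget_matching that assms by blast
  from tutte_minimal[OF simple_graph_gadget even_card_gadget this]
  show ?thesis using barrier_of_gadget by blast
qed

end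

section \<open>Extremal barriers\<close>

lemma card_arcs_Union:
  assumes "finite A" "finite \<D>" "\<And>D. D \<in> \<D> \<Longrightarrow> finite D" "pairwise disjnt \<D>"
  shows "card (arcs E A (\<Union>\<D>)) = (\<Sum>D\<in>\<D>. card (arcs E A D))"
proof -
  have "arcs E A (\<Union>\<D>) = (\<Union>D\<in>\<D>. arcs E A D)" by (auto simp: arcs_def)
  moreover have "arcs E A D \<inter> arcs E A D' = {}" if "D \<in> \<D>" "D' \<in> \<D>" "D \<noteq> D'" for D D'
    using pairwiseD[OF assms(4) that] by (auto simp: arcs_def disjnt_def)
  ultimately show ?thesis using assms by (simp add: card_UN_disjoint)
qed

lemma barrier_finite:
  assumes "simple_graph V E" "barrier V E S T \<D>"
  shows "finite S" "finite T" "finite \<D>" "\<And>D. D \<in> \<D> \<Longrightarrow> finite D"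
proof -
  have fV: "finite V" using assms simple_graph_finite by blast
  have "S \<subseteq> V" "T \<subseteq> V" "\<D> \<subseteq> Pow V" using assms(2) by (auto simp: barrier_def)
  then show "finite S" "finite T" "finite \<D>" "\<And>D. D \<in> \<D> \<Longrightarrow> finite D"
    using fV by (auto intro: finite_subset[of _ V] finite_subset[of _ "Pow V"])
qed

text \<open>Modulo 2 the edges at \<open>T\<close> outside \<open>S\<close> are those to the
  members, one each, and those to the rest \<open>R\<close>, as edges inside \<open>T\<close> count
  twice. If the surplus is exactly 1, then \<open>R\<close> sends an odd number of edges to
  \<open>T\<close> and can be added as a member.\<close>

lemma barrier_parity:
  assumes G: "simple_graph V E" and B: "barrier V E S T \<D>"
  shows "\<exists>\<D>'. barrier V E S T \<D>' \<and> 2 * card S + card (arcs E T (V - S)) + 2 \<le> 2 * card T + card \<D>'"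
proof (cases "2 * card S + card (arcs E T (V - S)) + 2 \<le> 2 * card T + card \<D>")
  case True
  then show ?thesis using B by blast
next
  case False
  note fin = barrier_finite[OF G B]
  have fV: "finite V" using G simple_graph_finite by blast
  have sub: "S \<subseteq> V" "T \<subseteq> V" "S \<inter> T = {}" and disj: "pairwise disjnt \<D>"
    and D: "\<And>D. D \<in> \<D> \<Longrightarrow> D \<subseteq> V - S - T" "\<And>D. D \<in> \<D> \<Longrightarrow> odd (card (arcs E D T))"
    and closed: "\<And>D x y. D \<in> \<D> \<Longrightarrow> x \<in> D \<Longrightarrow> {x, y} \<in> E \<Longrightarrow> y \<in> D \<union> S \<union> T"
    and less: "2 * card S + card (arcs E T (V - S)) < 2 * card T + card \<D>"
    using B unfolding barrier_def by blast+
  have tight: "Suc (2 * card S + card (arcs E T (V - S))) = 2 * card T + card \<D>" using less False by linarith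
  define R where "R = V - S - T - \<Union>\<D>"
  have UD: "\<Union>\<D> \<subseteq> V - S - T" using D(1) by (intro Union_least)
  then have VS: "V - S = T \<union> (\<Union>\<D> \<union> R)" using sub by (auto simp: R_def)
  have "card (arcs E T (V - S)) = card (arcs E T T) + card (arcs E T (\<Union>\<D>)) + card (arcs E T R)"
  proof -
    have "T \<inter> (\<Union>\<D> \<union> R) = {}" "\<Union>\<D> \<inter> R = {}" using UD by (auto simp: R_def)
    moreover have "finite (\<Union>\<D>)" "finite R" using fin fV by (auto simp: R_def)
    ultimately show ?thesis unfolding VS using fin(2) by (simp add: card_arcs_Un)
  qed
  moreover have "even (card (arcs E T (\<Union>\<D>))) = even (card \<D>)"
  proof -
    have "{D \<in> \<D>. odd (card (arcs E T D))} = \<D>" using D(2) card_arcs_commute[of E _ T] by auto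
    then show ?thesis
      using card_arcs_Union[OF fin(2,3,4) disj] fin(3) by (simp add: even_sum_iff)
  qed
  moreover have "even (card (arcs E T T))" using even_card_arcs[OF G sub(2)] .
  moreover have "odd (card (arcs E T (V - S)) + card \<D>)"
  proof -
    have "Suc (2 * card S + card (arcs E T (V - S))) + card \<D> = 2 * (card T + card \<D>)" using tight by simp
    then have "even (Suc (2 * card S + card (arcs E T (V - S))) + card \<D>)" by simp
    then show ?thesis by simp
  qed
  ultimately have oddR: "odd (card (arcs E R T))"
    using card_arcs_commute[of E R T] by auto
  then have "R \<noteq> {}" by (auto simp: arcs_def)
  moreover have "R \<inter> D = {}" if "D \<in> \<D>" for D using that by (auto simp: R_def)
  ultimately have "R \<notin> \<D>" by auto
  moreover have "y \<in> R \<union> S \<union> T" if x: "x \<in> R" and xy: "{x, y} \<in> E" for x y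
  proof (rule ccontr)
    assume y: "y \<notin> R \<union> S \<union> T"
    then obtain D where "D \<in> \<D>" "y \<in> D" using simple_graph_edge[OF G xy] by (auto simp: R_def)
    then have "x \<in> D \<union> S \<union> T" using closed[of D y x] xy by (simp add: insert_commute)
    then show False using x \<open>D \<in> \<D>\<close> by (auto simp: R_def)
  qed
  moreover have "pairwise disjnt (insert R \<D>)"
    using disj by (auto simp: pairwise_insert disjnt_def R_def)
  moreover have "R \<subseteq> V - S - T" by (auto simp: R_def)
  moreover have "card (insert R \<D>) = Suc (card \<D>)" using \<open>R \<notin> \<D>\<close> fin by simp
  ultimately have "barrier V E S T (insert R \<D>)"
    using B oddR unfolding barrier_def by auto
  then show ?thesis using tight \<open>card (insert R \<D>) = Suc (card \<D>)\<close>
    by (intro exI[of _ "insert R \<D>"]) auto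
qed

text \<open>A barrier with \<open>card T - card S\<close> minimal. Violating the third or the fourth
  property would allow dropping a vertex from \<open>T\<close> or moving a vertex of a member into
  \<open>S\<close>; the surplus of 2 absorbs the loss in the inequality.\<close>

lemma tight_barrier:
  assumes G: "simple_graph V E" and no: "\<nexists>F. two_factor V E F"
  shows "\<exists>S T \<D>. barrier V E S T \<D> \<and>
    2 * card S + card (arcs E T (V - S)) + 2 \<le> 2 * card T + card \<D> \<and>
    (\<forall>t\<in>T. \<forall>u. {t, u} \<in> E \<longrightarrow> u \<in> S \<union> \<Union>\<D>) \<and>
    (\<forall>D\<in>\<D>. \<forall>x\<in>D. \<forall>t\<in>T. \<forall>t'\<in>T. {x, t} \<in> E \<longrightarrow> {x, t'} \<in> E \<longrightarrow> t = t')"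
proof -
  have fV: "finite V" using G simple_graph_finite by blast
  let ?P = "\<lambda>(S, T). \<exists>\<D>. barrier V E S T \<D>"
  \<comment> \<open>This is \<open>card T - card S\<close> shifted by \<open>card V\<close>, so that
    it stays a natural number.\<close>
  let ?m = "\<lambda>(S, T). card T + card (V - S)"
  obtain p where p: "?P p" and pmin: "\<And>q. ?P q \<Longrightarrow> ?m p \<le> ?m q"
    using two_factor_or_barrier[OF G no] ex_has_least_nat[of ?P _ ?m] by blast
  obtain S T where "p = (S, T)" by (cases p)
  then obtain \<D>0 where "barrier V E S T \<D>0"
    and min: "\<And>S' T' \<D>'. barrier V E S' T' \<D>' \<Longrightarrow> card T + card (V - S) \<le> card T' + card (V - S')"
    using p pmin by fastforce
  then obtain \<D> where B: "barrier V E S T \<D>"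
    and tight: "2 * card S + card (arcs E T (V - S)) + 2 \<le> 2 * card T + card \<D>"
    using barrier_parity[OF G] by blast
  note fin = barrier_finite[OF G B]
  have sub: "S \<subseteq> V" "T \<subseteq> V" "S \<inter> T = {}" and disj: "pairwise disjnt \<D>"
    and D: "\<And>D. D \<in> \<D> \<Longrightarrow> D \<subseteq> V - S - T" "\<And>D. D \<in> \<D> \<Longrightarrow> odd (card (arcs E D T))"
    and closed: "\<And>D x y. D \<in> \<D> \<Longrightarrow> x \<in> D \<Longrightarrow> {x, y} \<in> E \<Longrightarrow> y \<in> D \<union> S \<union> T"
    using B unfolding barrier_def by blast+
  have "u \<in> S \<union> \<Union>\<D>" if t: "t \<in> T" and tu: "{t, u} \<in> E" for t u
  proof (rule ccontr)
    assume u: "u \<notin> S \<union> \<Union>\<D>"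
    define T' where "T' = T - {t}"
    define A where "A = {D \<in> \<D>. \<exists>x\<in>D. {t, x} \<in> E}"
    define N where "N = {w \<in> V - S. {t, w} \<in> E}"
    have uN: "u \<in> N" using simple_graph_edge[OF G tu] u tu by (auto simp: N_def)
    have fN: "finite N" using fV by (auto simp: N_def)
    \<comment> \<open>Each member joined to \<open>t\<close> contains a vertex of \<open>N\<close>,
      and none contains \<open>u\<close>. Dropping \<open>t\<close> therefore saves more edges than
      it costs members.\<close>
    have "card A \<le> card (N - {u})"
    proof (rule card_disjoint_family_le)
      show "pairwise disjnt A" using disj by (auto simp: A_def pairwise_def)
      show "C \<inter> (N - {u}) \<noteq> {}" if "C \<in> A" for C
        using that u D(1) by (fastforce simp: A_def N_def)
    qed (use fN in auto)
    then have AN: "card A < card N" using card_Suc_Diff1[OF fN uN] by linarith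
    have "card (arcs E T (V - S)) = card (arcs E T' (V - S)) + card N"
    proof -
      have "arcs E {t} (V - S) = Pair t ` N" by (auto simp: arcs_def N_def)
      then have "card (arcs E (V - S) {t}) = card N"
        by (simp add: card_arcs_commute[of E "V - S"] card_image inj_on_def)
      moreover have "T' \<union> {t} = T" using t by (auto simp: T'_def)
      ultimately show ?thesis
        using card_arcs_Un[of "V - S" T' "{t}" E] fV fin(2) card_arcs_commute[of E _ "V - S"]
        by (simp add: T'_def)
    qed
    moreover have cT: "card T = Suc (card T')" using card_Suc_Diff1[OF fin(2) t] by (simp add: T'_def)
    moreover have "card (\<D> - A) = card \<D> - card A" "card A \<le> card \<D>"
      using fin(3) by (auto simp: A_def intro!: card_Diff_subset card_mono)
    ultimately have "2 * card S + card (arcs E T' (V - S)) < 2 * card T' + card (\<D> - A)"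
      using tight AN by linarith
    moreover have "odd (card (arcs E C T'))" if "C \<in> \<D> - A" for C
    proof -
      have "arcs E C T' = arcs E C T" using that by (auto simp: arcs_def T'_def A_def insert_commute)
      then show ?thesis using D(2)[of C] that by simp
    qed
    moreover have "y \<in> C \<union> S \<union> T'" if "C \<in> \<D> - A" "x \<in> C" "{x, y} \<in> E" for C x y
      using closed[of C x y] that by (auto simp: A_def T'_def insert_commute)
    moreover have "C \<subseteq> V - S - T'" if "C \<in> \<D> - A" for C using D(1)[of C] that by (auto simp: T'_def)
    moreover have "pairwise disjnt (\<D> - A)" using disj by (auto simp: pairwise_def)
    moreover have "T' \<subseteq> V" "S \<inter> T' = {}" using sub by (auto simp: T'_def)
    ultimately have "barrier V E S T' (\<D> - A)" using sub(1) unfolding barrier_def by blast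
    from min[OF this] show False using cT by simp
  qed
  moreover have "t = t'" if C: "C \<in> \<D>" and x: "x \<in> C" and t: "t \<in> T" "t' \<in> T" "{x, t} \<in> E" "{x, t'} \<in> E"
    for C x t t'
  proof (rule ccontr)
    assume "t \<noteq> t'"
    define S' where "S' = insert x S"
    have xV: "x \<in> V" "x \<notin> S" "x \<notin> T" using D(1)[OF C] x by auto
    have cS: "card S' = Suc (card S)" using xV fin(1) by (simp add: S'_def)
    have VS: "V - S = (V - S') \<union> {x}" using xV by (auto simp: S'_def)
    have "card (arcs E T (V - S)) = card (arcs E T (V - S')) + card (arcs E T {x})"
      unfolding VS using fV fin(2) by (intro card_arcs_Un) (auto simp: S'_def)
    moreover have "{(t, x), (t', x)} \<subseteq> arcs E T {x}" using t by (auto simp: arcs_def insert_commute)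
    then have "card {(t, x), (t', x)} \<le> card (arcs E T {x})" using fin(2) by (intro card_mono) auto
    moreover have "card {(t, x), (t', x)} = 2" using \<open>t \<noteq> t'\<close> by simp
    moreover have "Suc (card (\<D> - {C})) = card \<D>" using card_Suc_Diff1[OF fin(3) C] .
    \<comment> \<open>The larger \<open>S'\<close> costs 2 and the lost member \<open>C\<close>
      costs 1, while at least two edges between \<open>x\<close> and \<open>T\<close> are saved: a
      surplus of 1 remains.\<close>
    ultimately have less: "2 * card S' + card (arcs E T (V - S')) < 2 * card T + card (\<D> - {C})"
      using tight cS by linarith
    have "barrier V E S' T (\<D> - {C})"
      unfolding barrier_def
    proof (intro conjI ballI allI impI less)
      show "S' \<subseteq> V" "S' \<inter> T = {}" "T \<subseteq> V" using sub xV by (auto simp: S'_def)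
      show "pairwise disjnt (\<D> - {C})" using disj by (auto simp: pairwise_def)
      fix C' assume C': "C' \<in> \<D> - {C}"
      show "C' \<subseteq> V - S' - T"
        using D(1)[of C'] C' pairwiseD[OF disj C, of C'] x by (auto simp: S'_def disjnt_def)
      show "odd (card (arcs E C' T))" using D(2) C' by blast
      show "y \<in> C' \<union> S' \<union> T" if "z \<in> C'" "{z, y} \<in> E" for z y
        using closed[of C' z y] that C' by (auto simp: S'_def)
    qed
    from min[OF this] have "card (V - S) \<le> card (V - S')" by simp
    moreover have "card (V - S') < card (V - S)"
      using xV fV by (intro psubset_card_mono) (auto simp: S'_def)
    ultimately show False by simp
  qed
  ultimately show ?thesis using B tight by blast
qed

section \<open>Vizing's adjacency lemma\<close>

definition missing :: "'a set set \<Rightarrow> nat \<Rightarrow> ('a set \<Rightarrow> nat) \<Rightarrow> 'a \<Rightarrow> nat set" where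
  "missing F k c v = {a. a < k \<and> (\<forall>e\<in>F. v \<in> e \<longrightarrow> c e \<noteq> a)}"

text \<open>Vizing's multifan at \<open>x\<close>, with \<open>{x, f 0}\<close> as the uncoloured
  edge. The colour of an edge is missing at some earlier vertex, not necessarily at the preceding
  one.\<close>

definition fan :: "'a set set \<Rightarrow> nat \<Rightarrow> ('a set \<Rightarrow> nat) \<Rightarrow> 'a \<Rightarrow> (nat \<Rightarrow> 'a) \<Rightarrow> nat \<Rightarrow> bool" where
  "fan E k c x f n \<longleftrightarrow> (\<forall>i\<le>n. {x, f i} \<in> E) \<and> inj_on f {..n} \<and>
     (\<forall>i\<le>n. 0 < i \<longrightarrow> (\<exists>j<i. c {x, f i} \<in> missing (E - {{x, f 0}}) k c (f j)))"

lemma proper_edge_coloringD: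
  assumes "proper_edge_coloring F k c" "e \<in> F" "f \<in> F" "v \<in> e" "v \<in> f" "c e = c f"
  shows "e = f"
  using assms unfolding proper_edge_coloring_def by blast

text \<open>The edge \<open>e\<close> may or may not lie in \<open>F\<close>, so this serves both
  for extending a colouring and for recolouring an edge.\<close>

lemma proper_edge_coloring_upd:
  assumes c: "proper_edge_coloring F k c" and a: "a < k"
    and fresh: "\<And>f v. f \<in> F \<Longrightarrow> f \<noteq> e \<Longrightarrow> v \<in> e \<Longrightarrow> v \<in> f \<Longrightarrow> c f \<noteq> a"
  shows "proper_edge_coloring (insert e F) k (c(e := a))"
  unfolding proper_edge_coloring_def
proof (intro conjI ballI impI)
  fix g assume g: "g \<in> insert e F"
  then show "(c(e := a)) g < k" using c a by (auto simp: proper_edge_coloring_def)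
  fix h assume h: "h \<in> insert e F" and gh: "g \<noteq> h \<and> g \<inter> h \<noteq> {}"
  then obtain v where v: "v \<in> g" "v \<in> h" by blast
  consider "g = e" | "h = e" | "g \<noteq> e" "h \<noteq> e" by blast
  then show "(c(e := a)) g \<noteq> (c(e := a)) h"
  proof cases
    case 1
    then show ?thesis using fresh[of h v] h gh v by auto
  next
    case 2
    then show ?thesis using fresh[of g v] g gh v by auto
  next
    case 3
    then show ?thesis using proper_edge_coloringD[OF c, of g h v] g h gh v by auto
  qed
qed

lemma missing_upd: "v \<notin> e \<Longrightarrow> missing F k (c(e := a)) v = missing F k c v"
  by (auto simp: missing_def)

lemma card_missing:
  assumes "proper_edge_coloring F k c" "finite F"
  shows "card (missing F k c v) + degree F v = k"
proof -
  have inj: "inj_on c {e \<in> F. v \<in> e}"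
    using proper_edge_coloringD[OF assms(1)] by (intro inj_onI) auto
  have sub: "c ` {e \<in> F. v \<in> e} \<subseteq> {..<k}" using assms(1) by (auto simp: proper_edge_coloring_def)
  have "missing F k c v = {..<k} - c ` {e \<in> F. v \<in> e}" by (auto simp: missing_def)
  then have "card (missing F k c v) = k - degree F v"
    using assms(2) sub by (simp add: card_Diff_subset degree_def card_image[OF inj])
  moreover have "degree F v \<le> k"
    using card_mono[OF _ sub] by (simp add: degree_def card_image[OF inj])
  ultimately show ?thesis by simp
qed

section \<open>Recolouring of fans\<close>

lemma fan_mono: "fan E k c x f n \<Longrightarrow> m \<le> n \<Longrightarrow> fan E k c x f m"
  unfolding fan_def by (auto intro: inj_on_subset)

lemma fan_eq_iff: "fan E k c x f n \<Longrightarrow> i \<le> n \<Longrightarrow> j \<le> n \<Longrightarrow> f i = f j \<longleftrightarrow> i = j"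
  unfolding fan_def by (metis atMost_iff inj_on_eq_iff)

lemma fan_edge:
  assumes "fan E k c x f n" "i \<le> n" "0 < i"
  shows "{x, f i} \<in> E - {{x, f 0}}"
proof -
  have "f i \<noteq> f 0" using fan_eq_iff[OF assms(1,2), of 0] assms(3) by simp
  then show ?thesis using assms by (auto simp: fan_def doubleton_eq_iff)
qed

lemma fan_pred:
  assumes "fan E k c x f n" "i \<le> n" "0 < i"
  obtains j where "j < i" "c {x, f i} \<in> missing (E - {{x, f 0}}) k c (f j)"
  using assms unfolding fan_def by blast

text \<open>If \<open>a\<close> were missing at both ends, \<open>{x, f n}\<close> could be
  recoloured with \<open>a\<close>. This frees its old colour at \<open>x\<close>, and that colour
  is missing at an earlier fan vertex \<open>f j\<close>, so the argument repeats with a shorter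
  fan. It ends with a colour for the uncoloured edge \<open>{x, f 0}\<close>. Since the colouring
  changes, the induction generalises over \<open>c\<close> and \<open>a\<close>.\<close>

lemma fan_missing_center:
  assumes G: "simple_graph V E" and no: "\<nexists>c. proper_edge_coloring E k c"
    and "proper_edge_coloring (E - {{x, f 0}}) k c" "fan E k c x f n"
    and "a \<in> missing (E - {{x, f 0}}) k c x"
  shows "a \<notin> missing (E - {{x, f 0}}) k c (f n)"
  using assms(3-)
proof (induction n arbitrary: c a rule: less_induct)
  case (less n)
  let ?F = "E - {{x, f 0}}"
  note c = less.prems(1) and fan = less.prems(2) and a = less.prems(3)
  have xE: "{x, f i} \<in> E" if "i \<le> n" for i using fan that by (auto simp: fan_def)
  show ?case
  proof
    assume an: "a \<in> missing ?F k c (f n)"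
    have ak: "a < k" using a by (auto simp: missing_def)
    have fresh: "c g \<noteq> a" if "g \<in> ?F" "v \<in> {x, f n}" "v \<in> g" for g v
      using that a an by (auto simp: missing_def)
    show False
    proof (cases "n = 0")
      case True
      have "proper_edge_coloring (insert {x, f 0} ?F) k (c({x, f 0} := a))"
        using fresh True by (intro proper_edge_coloring_upd[OF c ak]) auto
      moreover have "insert {x, f 0} ?F = E" using xE[of 0] by auto
      ultimately show False using no by metis
    next
      case False
      then obtain j where j: "j < n" "c {x, f n} \<in> missing ?F k c (f j)"
        using fan_pred[OF fan, of n] by auto
      define b where "b = c {x, f n}"
      define c' where "c' = c({x, f n} := a)"
      have e: "{x, f n} \<in> ?F" using fan_edge[OF fan] False by simp
      have c': "proper_edge_coloring ?F k c'"
        using proper_edge_coloring_upd[OF c ak, of "{x, f n}"] fresh e by (simp add: c'_def insert_absorb)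
      have ab: "a \<noteq> b" using fresh[OF e, of x] by (auto simp: b_def)
      have same: "missing ?F k c' (f i) = missing ?F k c (f i)" if "i < n" for i
      proof -
        have "f i \<noteq> f n" using fan_eq_iff[OF fan, of i n] that by simp
        moreover have "f i \<noteq> x" using simple_graph_edge(1)[OF G xE[of i]] that by auto
        ultimately show ?thesis unfolding c'_def by (intro missing_upd) auto
      qed
      have "b < k" using c e unfolding b_def proper_edge_coloring_def by blast
      then have "b \<in> missing ?F k c' x"
        using proper_edge_coloringD[OF c _ e, of _ x] ab by (auto simp: missing_def c'_def b_def)
      moreover have "fan E k c' x f j"
        unfolding fan_def
      proof (intro conjI allI impI)
        show "inj_on f {..j}" using fan j by (auto simp: fan_def intro: inj_on_subset)
        fix i assume i: "i \<le> j"
        then show "{x, f i} \<in> E" using xE j by simp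
        assume "0 < i"
        then obtain l where l: "l < i" "c {x, f i} \<in> missing ?F k c (f l)"
          using fan_pred[OF fan, of i] i j by auto
        have "f i \<noteq> f n" using fan_eq_iff[OF fan, of i n] i j by simp
        then have "c' {x, f i} = c {x, f i}" by (auto simp: c'_def doubleton_eq_iff)
        then show "\<exists>l<i. c' {x, f i} \<in> missing ?F k c' (f l)" using l same[of l] i j by auto
      qed
      ultimately have "b \<notin> missing ?F k c' (f j)" using less.IH[OF j(1) c'] by blast
      then show False using j same[of j] by (simp add: b_def)
    qed
  qed
qed

text \<open>
  Here \<open>K\<close> will be the Kempe component of the centre of a fan; swapping outside of it keeps the
  colours of the fan edges.
\<close>

definition kempe_swap :: "'a set \<Rightarrow> nat \<Rightarrow> nat \<Rightarrow> ('a set \<Rightarrow> nat) \<Rightarrow> 'a set \<Rightarrow> nat" where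
  "kempe_swap K a b c e =
     (if e \<inter> K \<noteq> {} then c e else if c e = a then b else if c e = b then a else c e)"

text \<open>By \<open>closed\<close>, no edge coloured \<open>a\<close> or \<open>b\<close> leaves
  \<open>K\<close>. Two such edges with a common vertex are thus both swapped or both kept.\<close>

lemma kempe_swap:
  assumes c: "proper_edge_coloring F k c" and ab: "a < k" "b < k" "a \<noteq> b"
    and closed: "\<forall>e\<in>F. c e \<in> {a, b} \<longrightarrow> e \<inter> K \<noteq> {} \<longrightarrow> e \<subseteq> K"
  shows "proper_edge_coloring F k (kempe_swap K a b c)"
    and "v \<in> K \<Longrightarrow> missing F k (kempe_swap K a b c) v = missing F k c v"
    and "d \<notin> {a, b} \<Longrightarrow> d \<in> missing F k (kempe_swap K a b c) v \<longleftrightarrow> d \<in> missing F k c v"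
    and "v \<notin> K \<Longrightarrow> a \<in> missing F k (kempe_swap K a b c) v \<longleftrightarrow> b \<in> missing F k c v"
proof -
  note K = closed[rule_format]
  show "proper_edge_coloring F k (kempe_swap K a b c)"
    unfolding proper_edge_coloring_def
  proof (intro conjI ballI impI)
    fix e assume e: "e \<in> F"
    then show "kempe_swap K a b c e < k" using c ab by (auto simp: kempe_swap_def proper_edge_coloring_def)
    fix f assume f: "f \<in> F" and ef: "e \<noteq> f \<and> e \<inter> f \<noteq> {}"
    then obtain v where v: "v \<in> e" "v \<in> f" by blast
    have "c e \<noteq> c f" using proper_edge_coloringD[OF c e f v] ef by blast
    moreover have "e \<inter> K \<noteq> {} \<longleftrightarrow> f \<inter> K \<noteq> {}" if "c e \<in> {a, b}" "c f \<in> {a, b}"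
      using K[OF e that(1)] K[OF f that(2)] v by blast
    ultimately show "kempe_swap K a b c e \<noteq> kempe_swap K a b c f"
      by (auto simp: kempe_swap_def split: if_splits)
  qed
  show "v \<in> K \<Longrightarrow> missing F k (kempe_swap K a b c) v = missing F k c v"
    unfolding missing_def kempe_swap_def by (intro Collect_cong conj_cong ball_cong) auto
  show "d \<notin> {a, b} \<Longrightarrow> d \<in> missing F k (kempe_swap K a b c) v \<longleftrightarrow> d \<in> missing F k c v"
    unfolding missing_def kempe_swap_def by (auto split: if_splits)
  show "a \<in> missing F k (kempe_swap K a b c) v \<longleftrightarrow> b \<in> missing F k c v" if v: "v \<notin> K"
  proof -
    have "kempe_swap K a b c e = a \<longleftrightarrow> c e = b" if e: "e \<in> F" "v \<in> e" for e
    proof (cases "c e \<in> {a, b}")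
      case True
      then have "e \<inter> K = {}" using K[OF e(1)] e(2) v by blast
      then show ?thesis using ab by (auto simp: kempe_swap_def)
    next
      case False
      then show ?thesis using ab by (auto simp: kempe_swap_def)
    qed
    then show ?thesis using ab by (auto simp: missing_def)
  qed
qed

section \<open>Components of two-coloured subgraphs\<close>

definition reach :: "'a set set \<Rightarrow> 'a \<Rightarrow> 'a set" where
  "reach H x = {w. (x, w) \<in> {(u, v). {u, v} \<in> H}\<^sup>*}"

lemma reach_refl: "x \<in> reach H x"
  by (simp add: reach_def)

lemma reach_step: "u \<in> reach H x \<Longrightarrow> {u, v} \<in> H \<Longrightarrow> v \<in> reach H x"
  unfolding reach_def by (auto intro: rtrancl_into_rtrancl)

lemma reach_least:
  assumes "x \<in> X" "\<And>u v. u \<in> X \<Longrightarrow> {u, v} \<in> H \<Longrightarrow> v \<in> X"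
  shows "reach H x \<subseteq> X"
proof
  fix w assume "w \<in> reach H x"
  then have "(x, w) \<in> {(u, v). {u, v} \<in> H}\<^sup>*" by (simp add: reach_def)
  then show "w \<in> X" by (induction rule: rtrancl_induct) (use assms in auto)
qed

text \<open>The component is grown from \<open>x\<close> one vertex at a time, and every new vertex
  brings a new edge.\<close>

lemma reach_edges:
  assumes "finite H" "finite (reach H x)"
  shows "card (reach H x) \<le> Suc (card {e \<in> H. e \<subseteq> reach H x})"
proof -
  let ?K = "reach H x"
  have "\<exists>X\<subseteq>?K. x \<in> X \<and> card X = Suc n \<and> n \<le> card {e \<in> H. e \<subseteq> X}" if "Suc n \<le> card ?K" for n
    using that
  proof (induction n)
    case 0
    then show ?case using reach_refl by (intro exI[of _ "{x}"]) auto
  next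
    case (Suc n)
    then obtain X where X: "X \<subseteq> ?K" "x \<in> X" "card X = Suc n" "n \<le> card {e \<in> H. e \<subseteq> X}" by auto
    have "\<not> ?K \<subseteq> X" using X Suc.prems by auto
    then obtain u v where uv: "u \<in> X" "{u, v} \<in> H" "v \<notin> X" using reach_least[of x X H] X(2) by blast
    have fX: "finite X" using X(1) assms(2) finite_subset by blast
    have "card (insert {u, v} {e \<in> H. e \<subseteq> X}) \<le> card {e \<in> H. e \<subseteq> insert v X}"
      using uv assms(1) by (intro card_mono) auto
    moreover have "card (insert {u, v} {e \<in> H. e \<subseteq> X}) = Suc (card {e \<in> H. e \<subseteq> X})"
      using uv assms(1) by (intro card_insert_disjoint) auto
    moreover have "insert v X \<subseteq> ?K" using X(1) uv reach_step by fast
    ultimately show ?case using X uv fX by (intro exI[of _ "insert v X"]) auto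
  qed
  moreover have "card ?K \<noteq> 0" using assms(2) reach_refl by (metis card_0_eq empty_iff)
  ultimately obtain X where X: "X \<subseteq> ?K" "card X = card ?K" "card ?K - 1 \<le> card {e \<in> H. e \<subseteq> X}"
    by (metis Suc_pred' bot_nat_0.not_eq_extremum diff_Suc_1 order_refl)
  then have "X = ?K" using assms(2) card_subset_eq by blast
  then show ?thesis using X by simp
qed

text \<open>
  A component of a graph of maximum degree two is a path or a cycle; instead of analysing its
  shape, the proof compares the degree sum with the number of edges of a connected graph.
\<close>

lemma reach_three_ends:
  assumes G: "simple_graph V H" and deg: "\<And>v. degree H v \<le> 2"
    and ends: "degree H x \<le> 1" "degree H u \<le> 1" "degree H v \<le> 1"
    and "x \<noteq> u" "x \<noteq> v" "u \<noteq> v" "x \<in> V" "u \<in> reach H x" "v \<in> reach H x"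
  shows False
proof -
  let ?K = "reach H x"
  let ?H = "{e \<in> H. e \<subseteq> ?K}"
  have fH: "finite H" and fV: "finite V" using G simple_graph_finite by blast+
  have "?K \<subseteq> V" using simple_graph_edge(3)[OF G] \<open>x \<in> V\<close> by (intro reach_least) auto
  then have fK: "finite ?K" using fV finite_subset by blast
  have "{e \<in> H. w \<in> e} = {e \<in> ?H. w \<in> e}" if w: "w \<in> ?K" for w
  proof -
    have "e \<subseteq> ?K" if e: "e \<in> H" "w \<in> e" for e
    proof -
      obtain z where "e = {w, z}" using simple_graph_edgeE[OF G e] by metis
      then show ?thesis using reach_step[OF w, of z] e w by auto
    qed
    then show ?thesis by blast
  qed
  then have "(\<Sum>w\<in>?K. degree H w) = (\<Sum>w\<in>?K. card {e \<in> ?H. w \<in> e})"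
    by (intro sum.cong) (simp_all add: degree_def)
  also have "\<dots> = 2 * card ?H"
  proof (rule sum_multicount)
    show "\<forall>e\<in>?H. card {w \<in> ?K. w \<in> e} = 2"
    proof
      fix e assume e: "e \<in> ?H"
      then have "{w \<in> ?K. w \<in> e} = e" by auto
      then show "card {w \<in> ?K. w \<in> e} = 2" using e G by (auto simp: simple_graph_def)
    qed
  qed (use fK fH in auto)
  finally have sum: "(\<Sum>w\<in>?K. degree H w) = 2 * card ?H" .
  define A where "A = {x, u, v}"
  \<comment> \<open>The three ends push the degree sum down to \<open>2 * card ?K - 3\<close>,
    whereas a connected graph has at least \<open>card ?K - 1\<close> edges.\<close>
  have "(\<Sum>w\<in>?K. degree H w) + card A \<le> 2 * card ?K"
  proof -
    have sub: "A \<subseteq> ?K" using assms reach_refl by (auto simp: A_def)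
    have "(\<Sum>w\<in>?K. degree H w + (if w \<in> A then 1 else 0)) \<le> (\<Sum>w\<in>?K. 2)"
      using deg ends by (intro sum_mono) (auto simp: A_def)
    moreover have "(\<Sum>w\<in>?K. if w \<in> A then 1 else 0) = card A"
      using fK sub by (simp add: sum.If_cases Int_absorb1)
    ultimately show ?thesis by (simp add: sum.distrib)
  qed
  moreover have "card A = 3" using assms by (simp add: A_def)
  ultimately show False using reach_edges[OF fH fK] sum by simp
qed

text \<open>Suppose \<open>b\<close> is missing at \<open>f i\<close> and \<open>f n\<close>, and
  \<open>a\<close> at \<open>x\<close>. In the subgraph of colours \<open>a\<close> and
  \<open>b\<close> all three have degree at most 1, so one of \<open>f i\<close>, \<open>f n\<close>
  lies outside the component \<open>K\<close> of \<open>x\<close>. Swapping the colours outside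
  \<open>K\<close> makes \<open>a\<close> missing there while the fan up to that vertex survives,
  against \<open>fan_missing_center\<close>.\<close>

lemma fan_missing_disjoint:
  assumes G: "simple_graph V E" and no: "\<nexists>c. proper_edge_coloring E k c"
    and c: "proper_edge_coloring (E - {{x, f 0}}) k c" and deg: "degree E x \<le> k"
    and "fan E k c x f n" "i < n"
  shows "missing (E - {{x, f 0}}) k c (f i) \<inter> missing (E - {{x, f 0}}) k c (f n) = {}"
  using assms(5-)
proof (induction n arbitrary: i rule: less_induct)
  case (less n)
  let ?F = "E - {{x, f 0}}"
  let ?m = "missing ?F k c"
  note fan = less.prems(1) and i = less.prems(2)
  have fE: "finite E" using G simple_graph_finite by blast
  have xE: "{x, f i} \<in> E" if "i \<le> n" for i using fan that by (auto simp: fan_def)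
  show ?case
  proof (rule ccontr)
    assume "?m (f i) \<inter> ?m (f n) \<noteq> {}"
    then obtain b where b: "b \<in> ?m (f i)" "b \<in> ?m (f n)" by blast
    \<comment> \<open>By induction the earlier fan vertices have disjoint sets of missing colours,
      so \<open>b\<close> is missing only at \<open>f i\<close> among them.\<close>
    have uniq: "p = i" if "p < n" "b \<in> ?m (f p)" for p
    proof (rule ccontr)
      assume "p \<noteq> i"
      then show False
        using less.IH[OF \<open>p < n\<close> fan_mono[OF fan], of i] less.IH[OF i fan_mono[OF fan], of p] that b i
        by (cases "p < i") auto
    qed
    have "degree ?F x < degree E x"
      unfolding degree_def using xE[of 0] fE by (intro psubset_card_mono) auto
    \<comment> \<open>The uncoloured edge at \<open>x\<close> leaves at least one of the
      \<open>k\<close> colours missing there.\<close>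
    then have "card (?m x) \<noteq> 0" using card_missing[OF c, of x] fE deg by simp
    then obtain a where a: "a \<in> ?m x" by fastforce
    have ai: "a \<notin> ?m (f i)"
      using fan_missing_center[where f = f and x = x, OF G no c fan_mono[OF fan] a, of i] i by simp
    have ab: "a \<noteq> b" "a < k" "b < k" using ai b a by (auto simp: missing_def)
    define H where "H = {e \<in> ?F. c e \<in> {a, b}}"
    have GF: "simple_graph V ?F" and GH: "simple_graph V H"
      using G by (auto simp: simple_graph_def H_def)
    have inj: "inj_on c {e \<in> H. v \<in> e}" for v
      using proper_edge_coloringD[OF c] by (intro inj_onI) (auto simp: H_def)
    have deg2: "degree H v \<le> 2" for v
    proof -
      have "card (c ` {e \<in> H. v \<in> e}) \<le> card {a, b}" by (intro card_mono) (auto simp: H_def)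
      then show ?thesis using ab by (simp add: card_image[OF inj] degree_def)
    qed
    have deg1: "degree H v \<le> 1" if d: "d \<in> {a, b}" "d \<in> ?m v" for d v
    proof -
      have "c ` {e \<in> H. v \<in> e} \<subseteq> {a, b} - {d}" using d(2) by (auto simp: H_def missing_def)
      then have "card (c ` {e \<in> H. v \<in> e}) \<le> card ({a, b} - {d})" by (intro card_mono) auto
      then show ?thesis using ab d(1) by (auto simp: card_image[OF inj] degree_def)
    qed
    define K where "K = reach H x"
    have xi: "x \<noteq> f i" "x \<noteq> f n" using simple_graph_edge(1)[OF G] xE i by auto
    have "f i \<noteq> f n" using fan_eq_iff[OF fan, of i n] i by simp
    then have out: "f i \<notin> K \<or> f n \<notin> K"
      using reach_three_ends[OF GH deg2, of x "f i" "f n"] deg1[of a x] deg1[of b] a b xi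
        simple_graph_edge(2)[OF G xE[of 0]] by (auto simp: K_def)
    define z where "z = (if f i \<notin> K then i else n)"
    have z: "z \<le> n" "f z \<notin> K" "b \<in> ?m (f z)" using out i b by (auto simp: z_def)
    define c' where "c' = kempe_swap K a b c"
    have xK: "x \<in> K" by (simp add: K_def reach_refl)
    have closed: "\<forall>e\<in>?F. c e \<in> {a, b} \<longrightarrow> e \<inter> K \<noteq> {} \<longrightarrow> e \<subseteq> K"
    proof (intro ballI impI)
      fix e assume e: "e \<in> ?F" "c e \<in> {a, b}" "e \<inter> K \<noteq> {}"
      have eH: "e \<in> H" using e by (simp add: H_def)
      obtain v where v: "v \<in> e" "v \<in> K" using e by blast
      obtain w where "e = {v, w}" using simple_graph_edgeE[OF GH eH v(1)] by metis
      then show "e \<subseteq> K" using reach_step[of v H x w] v eH by (auto simp: K_def)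
    qed
    note swap = kempe_swap[OF c ab(2,3,1) closed, folded c'_def]
    have "fan E k c' x f z"
      unfolding fan_def
    proof (intro conjI allI impI)
      show "inj_on f {..z}" using fan z by (auto simp: fan_def intro: inj_on_subset)
      fix l assume l: "l \<le> z"
      then show "{x, f l} \<in> E" using xE z by simp
      assume l0: "0 < l"
      then obtain p where p: "p < l" "c {x, f l} \<in> ?m (f p)"
        using fan_pred[OF fan, of l] l z by auto
      have same: "c' {x, f l} = c {x, f l}" using xK by (simp add: c'_def kempe_swap_def)
      have "c {x, f l} \<noteq> a" using a fan_edge[OF fan _ l0] l z by (auto simp: missing_def)
      \<comment> \<open>Only an edge coloured \<open>b\<close> could lose its predecessor. That
        predecessor is \<open>f i\<close>; as it precedes \<open>z\<close>, the choice of
        \<open>z\<close> gives \<open>z = n\<close> and \<open>f i \<in> K\<close>, where nothing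
        changes.\<close>
      moreover have "f p \<in> K" if "c {x, f l} = b"
      proof -
        have "p < n" using p l z by simp
        then have "p = i" using uniq p that by simp
        then show ?thesis using p l by (auto simp: z_def split: if_splits)
      qed
      ultimately have "c {x, f l} \<in> missing ?F k c' (f p)"
        using swap(2)[of "f p"] swap(3)[of "c {x, f l}" "f p"] p by (cases "c {x, f l} = b") auto
      then show "\<exists>p<l. c' {x, f l} \<in> missing ?F k c' (f p)" using p(1) same by auto
    qed
    moreover have "a \<in> missing ?F k c' x" using swap(2)[OF xK] a by simp
    ultimately have "a \<notin> missing ?F k c' (f z)"
      using fan_missing_center[where f = f and x = x, OF G no swap(1)] by blast
    then show False using swap(4)[OF z(2)] z(3) by simp
  qed
qed

text \<open>In a longest fan from \<open>y\<close>, the sets of colours missing at the fan vertices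
  are disjoint, and all these colours occur on the \<open>n\<close> coloured fan edges. Here
  \<open>y\<close> accounts for at least \<open>k + 1 - degree E y\<close> colours, and every later
  fan vertex of degree below \<open>k\<close> for at least one. So at least
  \<open>k + 1 - degree E y\<close> later fan vertices have degree \<open>k\<close>.\<close>

lemma vizing_adjacency:
  assumes G: "simple_graph V E" and no: "\<nexists>c. proper_edge_coloring E k c"
    and c: "proper_edge_coloring (E - {{x, y}}) k c"
    and deg: "\<And>v. degree E v \<le> k" and xy: "{x, y} \<in> E"
  shows "k + 1 \<le> degree E y + card {z. {x, z} \<in> E \<and> z \<noteq> y \<and> degree E z = k}"
proof -
  let ?F = "E - {{x, y}}"
  let ?m = "missing ?F k c"
  have fE: "finite E" and fV: "finite V" using G simple_graph_finite by blast+
  let ?P = "\<lambda>n. \<exists>f. f 0 = y \<and> fan E k c x f n"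
  have "?P 0" using xy by (intro exI[of _ "\<lambda>_. y"]) (auto simp: fan_def)
  moreover have "n < card V" if "?P n" for n
  proof -
    obtain f where "fan E k c x f n" using \<open>?P n\<close> by blast
    then have "inj_on f {..n}" "f ` {..n} \<subseteq> V" using simple_graph_edge(3)[OF G] by (auto simp: fan_def)
    then have "card {..n} \<le> card V" using fV card_inj_on_le by blast
    then show ?thesis by simp
  qed
  ultimately obtain n where n: "?P n" and max: "\<And>m. ?P m \<Longrightarrow> m \<le> n"
    using ex_has_greatest_nat[of ?P 0 "\<lambda>n. n" "card V"] by blast
  then obtain f where f0: "f 0 = y" and fan: "fan E k c x f n" by blast
  have c0: "proper_edge_coloring (E - {{x, f 0}}) k c" using c f0 by simp
  have inj: "inj_on f {..n}" and xE: "\<And>i. i \<le> n \<Longrightarrow> {x, f i} \<in> E" using fan by (auto simp: fan_def)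
  define C where "C = (\<Union>i\<le>n. ?m (f i))"
  \<comment> \<open>A colour missing at a fan vertex is present at \<open>x\<close>; the edge
    carrying it would extend the fan if its other end were not yet in it.\<close>
  have "C \<subseteq> (\<lambda>i. c {x, f i}) ` {1..n}"
  proof
    fix d assume "d \<in> C"
    then obtain i where i: "i \<le> n" "d \<in> ?m (f i)" by (auto simp: C_def)
    have "d \<notin> ?m x" using fan_missing_center[where f = f and x = x, OF G no c0 fan_mono[OF fan i(1)]] i(2) f0 by auto
    then obtain e where e: "e \<in> ?F" "x \<in> e" "c e = d" using i(2) by (auto simp: missing_def)
    obtain w where w: "e = {x, w}" using simple_graph_edgeE[OF G _ e(2)] e(1) by blast
    have "w \<in> f ` {..n}"
    proof (rule ccontr)
      assume wn: "w \<notin> f ` {..n}"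
      let ?f = "f(Suc n := w)"
      have "fan E k c x ?f (Suc n)"
        unfolding fan_def
      proof (intro conjI allI impI)
        show "inj_on ?f {..Suc n}"
          using inj wn by (auto simp: atMost_Suc inj_on_def image_iff)
        fix l assume l: "l \<le> Suc n"
        show "{x, ?f l} \<in> E" using l xE[of l] e w by (auto simp: le_Suc_eq)
        assume l0: "0 < l"
        show "\<exists>j<l. c {x, ?f l} \<in> missing (E - {{x, ?f 0}}) k c (?f j)"
        proof (cases "l = Suc n")
          case True
          then show ?thesis using i e w f0 by (intro exI[of _ i]) auto
        next
          case False
          then obtain j where "j < l" "c {x, f l} \<in> missing (E - {{x, f 0}}) k c (f j)"
            using fan_pred[OF fan, of l] l l0 by (auto simp: le_Suc_eq)
          then show ?thesis using False l by (intro exI[of _ j]) auto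
        qed
      qed
      then have "Suc n \<le> n" using f0 by (intro max exI[of _ ?f]) auto
      then show False by simp
    qed
    then obtain l where l: "l \<le> n" "w = f l" by auto
    have "l \<noteq> 0" using e(1) w l(2) f0 by auto
    then show "d \<in> (\<lambda>i. c {x, f i}) ` {1..n}" using e w l by auto
  qed
  then have "card C \<le> card {1..n}" by (intro surj_card_le) auto
  moreover have "card C = (\<Sum>i\<le>n. card (?m (f i)))"
    unfolding C_def
  proof (rule card_UN_disjoint)
    show "\<forall>i\<in>{..n}. finite (?m (f i))" by (auto simp: missing_def)
    have "?m (f i) \<inter> ?m (f j) = {}" if "i < j" "j \<le> n" for i j
      using fan_missing_disjoint[where f = f and x = x, OF G no c0 deg fan_mono[OF fan that(2)] that(1)] f0 by simp
    then show "\<forall>i\<in>{..n}. \<forall>j\<in>{..n}. i \<noteq> j \<longrightarrow> ?m (f i) \<inter> ?m (f j) = {}"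
      by (metis Int_commute atMost_iff nat_neq_iff)
  qed simp
  ultimately have le: "(\<Sum>i\<le>n. card (?m (f i))) \<le> n" by simp
  \<comment> \<open>The extra 1 comes from the uncoloured edge at \<open>y\<close>.\<close>
  have "k + 1 \<le> card (?m y) + degree E y"
  proof -
    have "degree ?F y < degree E y"
      unfolding degree_def using xy fE by (intro psubset_card_mono) auto
    then show ?thesis using card_missing[OF c, of y] fE by simp
  qed
  moreover have "n \<le> (\<Sum>i=1..n. card (?m (f i))) + card {z. {x, z} \<in> E \<and> z \<noteq> y \<and> degree E z = k}"
  proof -
    have "1 \<le> card (?m (f i)) + (if degree E (f i) = k then 1 else 0)" if "i \<in> {1..n}" for i
    proof -
      have "degree ?F (f i) \<le> degree E (f i)" unfolding degree_def using fE by (intro card_mono) auto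
      then show ?thesis using card_missing[OF c, of "f i"] fE deg[of "f i"] by (auto split: if_splits)
    qed
    then have "(\<Sum>i=1..n. 1) \<le> (\<Sum>i=1..n. card (?m (f i)) + (if degree E (f i) = k then 1 else 0))"
      by (intro sum_mono)
    then have "n \<le> (\<Sum>i=1..n. card (?m (f i))) + card {i \<in> {1..n}. degree E (f i) = k}"
      by (simp add: sum.distrib sum.If_cases Int_def)
    moreover have "card {i \<in> {1..n}. degree E (f i) = k} \<le> card {z. {x, z} \<in> E \<and> z \<noteq> y \<and> degree E z = k}"
    proof (rule card_inj_on_le)
      show "inj_on f {i \<in> {1..n}. degree E (f i) = k}" by (rule inj_on_subset[OF inj]) auto
      show "f ` {i \<in> {1..n}. degree E (f i) = k} \<subseteq> {z. {x, z} \<in> E \<and> z \<noteq> y \<and> degree E z = k}"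
        using xE inj f0 by (fastforce simp: inj_on_def)
      show "finite {z. {x, z} \<in> E \<and> z \<noteq> y \<and> degree E z = k}"
        using simple_graph_edge(3)[OF G] fV by (auto intro: finite_subset[of _ V])
    qed
    ultimately show ?thesis by linarith
  qed
  moreover have "(\<Sum>i\<le>n. card (?m (f i))) = card (?m y) + (\<Sum>i=1..n. card (?m (f i)))"
  proof -
    have "{..n} = insert 0 {1..n}" by auto
    then show ?thesis using f0 by simp
  qed
  ultimately show ?thesis using le by linarith
qed

lemma Delta_critical_coloring:
  assumes "Delta_critical V E"
  shows "\<nexists>c. proper_edge_coloring E (max_degree V E) c"
    and "e \<in> E \<Longrightarrow> \<exists>c. proper_edge_coloring (E - {e}) (max_degree V E) c"
proof -
  have G: "simple_graph V E" and chi: "chromatic_index E = max_degree V E + 1"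
    and crit: "\<And>e. e \<in> E \<Longrightarrow> chromatic_index (E - {e}) < chromatic_index E"
    using assms by (auto simp: Delta_critical_def critical_graph_def)
  show "\<nexists>c. proper_edge_coloring E (max_degree V E) c"
  proof
    assume "\<exists>c. proper_edge_coloring E (max_degree V E) c"
    then have "chromatic_index E \<le> max_degree V E"
      unfolding chromatic_index_def by (rule Least_le)
    then show False using chi by simp
  qed
  assume e: "e \<in> E"
  \<comment> \<open>An injective colouring shows that some number of colours suffices, so the
    \<open>LEAST\<close> in \<open>chromatic_index\<close> is attained.\<close>
  have "finite (E - {e})" using simple_graph_finite(2)[OF G] by simp
  then obtain c :: "'a set \<Rightarrow> nat" and n where "c ` (E - {e}) = {i. i < n}" "inj_on c (E - {e})"
    using finite_imp_inj_to_nat_seg by metis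
  then have "proper_edge_coloring (E - {e}) n c"
    by (auto simp: proper_edge_coloring_def inj_on_def)
  then have "\<exists>k c. proper_edge_coloring (E - {e}) k c" by blast
  then have "\<exists>c. proper_edge_coloring (E - {e}) (chromatic_index (E - {e})) c"
    unfolding chromatic_index_def by (rule LeastI_ex)
  then obtain d where d: "proper_edge_coloring (E - {e}) (chromatic_index (E - {e})) d" by blast
  have "chromatic_index (E - {e}) \<le> max_degree V E" using crit[OF e] chi by simp
  then have "proper_edge_coloring (E - {e}) (max_degree V E) d"
    using d unfolding proper_edge_coloring_def by (meson less_le_trans)
  then show "\<exists>c. proper_edge_coloring (E - {e}) (max_degree V E) c" by blast
qed

section \<open>The discharging argument\<close>

lemma degree_card_neighbours:
  assumes "simple_graph V E"
  shows "degree E v = card {u \<in> V. {v, u} \<in> E}"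
proof -
  have "{e \<in> E. v \<in> e} = (\<lambda>u. {v, u}) ` {u \<in> V. {v, u} \<in> E}"
    using simple_graph_edgeE[OF assms] simple_graph_edge[OF assms] by (auto simp: image_iff) metis
  moreover have "inj_on (\<lambda>u. {v, u}) {u \<in> V. {v, u} \<in> E}"
    by (auto simp: inj_on_def doubleton_eq_iff)
  ultimately show ?thesis by (simp add: degree_def card_image)
qed

lemma degree_le_max_degree:
  assumes "simple_graph V E"
  shows "degree E v \<le> max_degree V E"
proof (cases "v \<in> V")
  case True
  then show ?thesis using simple_graph_finite(1)[OF assms] by (simp add: max_degree_def)
next
  case False
  then have "{e \<in> E. v \<in> e} = {}" using assms by (auto simp: simple_graph_def)
  then show ?thesis by (simp only: degree_def card.empty)
qed

lemma card_arcs_sum: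
  assumes "finite A" "finite B"
  shows "card (arcs E A B) = (\<Sum>a\<in>A. card {b \<in> B. {a, b} \<in> E})"
proof -
  have "arcs E A B = (SIGMA a:A. {b \<in> B. {a, b} \<in> E})" by (auto simp: arcs_def)
  then show ?thesis using assms by simp
qed

theorem theorem1p2:
  fixes V :: "'a set" and E :: "'a set set" and n :: nat
  assumes "Delta_critical V E"
    and "card V = n"
    and "real (max_degree V E) \<ge> real n / 2"
  shows "\<exists>F. two_factor V E F"
proof (rule ccontr)
  assume no: "\<nexists>F. two_factor V E F"
  define \<Delta> where "\<Delta> = max_degree V E"
  have G: "simple_graph V E" and pos: "\<And>v. v \<in> V \<Longrightarrow> degree E v \<noteq> 0"
    using assms(1) by (auto simp: Delta_critical_def critical_graph_def)
  have n2: "card V \<le> 2 * \<Delta>" using assms(2,3) unfolding \<Delta>_def by linarith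
  have fV: "finite V" using simple_graph_finite(1)[OF G] .
  note nb = degree_card_neighbours[OF G]
  have deg: "degree E v \<le> \<Delta>" for v unfolding \<Delta>_def by (rule degree_le_max_degree[OF G])
  have VAL: "\<Delta> + 1 \<le> degree E y + card {z. {x, z} \<in> E \<and> z \<noteq> y \<and> degree E z = \<Delta>}"
    if xy: "{x, y} \<in> E" for x y
  proof -
    obtain c where "proper_edge_coloring (E - {{x, y}}) \<Delta> c"
      using Delta_critical_coloring(2)[OF assms(1) xy] unfolding \<Delta>_def by blast
    moreover have "\<nexists>c. proper_edge_coloring E \<Delta> c"
      using Delta_critical_coloring(1)[OF assms(1)] unfolding \<Delta>_def .
    ultimately show ?thesis using vizing_adjacency[OF G _ _ deg xy] by blast
  qed
  \<comment> \<open>A neighbour \<open>u\<close> of \<open>t\<close> has fewer than \<Delta> + 1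
    neighbours including \<open>t\<close>, so the adjacency lemma at \<open>u\<close> leaves no room
    for degree 1.\<close>
  have deg2: "2 \<le> degree E t" if t: "t \<in> V" for t
  proof -
    have "{u \<in> V. {t, u} \<in> E} \<noteq> {}" using pos[OF t] unfolding nb by fastforce
    then obtain u where u: "u \<in> V" "{u, t} \<in> E" by (auto simp: insert_commute)
    have "card {z. {u, z} \<in> E \<and> z \<noteq> t \<and> degree E z = \<Delta>} < card {z \<in> V. {u, z} \<in> E}"
      using u t fV simple_graph_edge(3)[OF G] by (intro psubset_card_mono) auto
    then show ?thesis using VAL[OF u(2)] deg[of u] nb[of u] by linarith
  qed
  obtain S T \<D> where B: "barrier V E S T \<D>"
    and tight: "2 * card S + card (arcs E T (V - S)) + 2 \<le> 2 * card T + card \<D>"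
    and into: "\<forall>t\<in>T. \<forall>u. {t, u} \<in> E \<longrightarrow> u \<in> S \<union> \<Union>\<D>"
    and single: "\<forall>D\<in>\<D>. \<forall>x\<in>D. \<forall>t\<in>T. \<forall>t'\<in>T. {x, t} \<in> E \<longrightarrow> {x, t'} \<in> E \<longrightarrow> t = t'"
    using tight_barrier[OF G no] by blast
  note fin = barrier_finite[OF G B]
  have sub: "S \<subseteq> V" "T \<subseteq> V" "S \<inter> T = {}" and disj: "pairwise disjnt \<D>"
    and D: "\<And>D. D \<in> \<D> \<Longrightarrow> D \<subseteq> V - S - T" "\<And>D. D \<in> \<D> \<Longrightarrow> odd (card (arcs E D T))"
    and closed: "\<And>D x y. D \<in> \<D> \<Longrightarrow> x \<in> D \<Longrightarrow> {x, y} \<in> E \<Longrightarrow> y \<in> D \<union> S \<union> T"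
    using B unfolding barrier_def by blast+
  have UD: "\<Union>\<D> \<subseteq> V - S - T" using D(1) by (intro Union_least)
  have fUD: "finite (\<Union>\<D>)" using fin by blast
  have card_V: "card S + card T + card (\<Union>\<D>) \<le> card V"
  proof -
    have "card S + card T + card (\<Union>\<D>) = card (S \<union> T \<union> \<Union>\<D>)"
      using fin fUD sub(3) UD by (subst card_Un_disjoint; (subst card_Un_disjoint)?) auto
    also have "\<dots> \<le> card V" using sub UD fV by (intro card_mono) auto
    finally show ?thesis .
  qed
  have edges_D: "(\<Sum>D\<in>\<D>. card (arcs E D T)) \<le> card (arcs E T (V - S))"
  proof -
    have "(\<Sum>D\<in>\<D>. card (arcs E D T)) = card (arcs E T (\<Union>\<D>))"
      using card_arcs_Union[OF fin(2,3,4) disj] card_arcs_commute[of E T] by simp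
    also have "\<dots> \<le> card (arcs E T (V - S))"
    proof (rule card_mono)
      show "finite (arcs E T (V - S))" using fin(2) fV by simp
      show "arcs E T (\<Union>\<D>) \<subseteq> arcs E T (V - S)" using UD by (auto simp: arcs_def)
    qed
    finally show ?thesis .
  qed
  have odd1: "1 \<le> card (arcs E D T)" if "D \<in> \<D>" for D using D(2)[OF that] by (cases "card (arcs E D T)") auto
  \<comment> \<open>Each member sends at least one edge to \<open>T\<close>, which cancels
    \<open>card \<D>\<close> against the edges in \<open>tight\<close>.\<close>
  have ST: "card S < card T"
  proof -
    have "(\<Sum>D\<in>\<D>. 1) \<le> (\<Sum>D\<in>\<D>. card (arcs E D T))" using odd1 by (intro sum_mono)
    then show ?thesis using tight edges_D by simp
  qed
  \<comment> \<open>By \<open>single\<close>, the neighbourhoods of \<open>t\<close> and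
    \<open>t'\<close> outside \<open>S\<close> are disjoint. Together they would give
    \<open>2 * \<Delta> \<le> 2 * card S + card (\<Union>\<D>)\<close>, which is less than
    \<open>card S + card T + card (\<Union>\<D>)\<close> and so less than
    \<open>2 * \<Delta>\<close>.\<close>
  have T_max: "t = t'" if t: "t \<in> T" "t' \<in> T" "degree E t = \<Delta>" "degree E t' = \<Delta>" for t t'
  proof (rule ccontr)
    assume "t \<noteq> t'"
    define N where "N t = {u \<in> \<Union>\<D>. {t, u} \<in> E}" for t
    have ND: "N t \<subseteq> \<Union>\<D>" for t by (auto simp: N_def)
    then have fN: "finite (N t)" for t using fUD finite_subset by blast
    have le: "degree E t \<le> card S + card (N t)" if "t \<in> T" for t
    proof -
      have "{u \<in> V. {t, u} \<in> E} \<subseteq> S \<union> N t" using into that by (auto simp: N_def)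
      then have "degree E t \<le> card (S \<union> N t)"
        unfolding nb using fin(1) fN by (intro card_mono) auto
      then show ?thesis using card_Un_le[of S "N t"] by linarith
    qed
    have "N t \<inter> N t' = {}" using single t(1,2) \<open>t \<noteq> t'\<close> by (auto simp: N_def insert_commute)
    then have "card (N t) + card (N t') = card (N t \<union> N t')"
      using fN by (intro card_Un_disjoint[symmetric]) auto
    also have "\<dots> \<le> card (\<Union>\<D>)" using fUD ND by (intro card_mono Un_least)
    finally show False using le[OF t(1)] le[OF t(2)] t(3,4) card_V ST n2 by linarith
  qed
  have D_max: "C = C'" if C: "C \<in> \<D>" "C' \<in> \<D>" "v \<in> C" "v' \<in> C'" "degree E v = \<Delta>" "degree E v' = \<Delta>"
    for C C' v v'
  proof (rule ccontr)
    assume "C \<noteq> C'"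
    \<comment> \<open>The vertex \<open>v\<close> itself is not among its neighbours in
      \<open>C\<close>, which makes up for its at most one neighbour in \<open>T\<close>. The
      contradiction is then the same count as for \<open>T\<close>.\<close>
    have le: "degree E v \<le> card S + card C" if v: "C \<in> \<D>" "v \<in> C" for C v
    proof -
      define N where "N = {t \<in> T. {v, t} \<in> E}"
      have "{u \<in> V. {v, u} \<in> E} \<subseteq> S \<union> (C - {v}) \<union> N"
        using closed[OF v] simple_graph_edge(1)[OF G] by (auto simp: N_def)
      then have "degree E v \<le> card (S \<union> (C - {v}) \<union> N)"
        unfolding nb using fin v by (intro card_mono) (auto simp: N_def)
      also have "\<dots> \<le> card S + card (C - {v}) + card N"
        by (meson add_le_mono card_Un_le le_refl le_trans)
      finally have "degree E v \<le> card S + card (C - {v}) + card N" .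
      moreover have "card N \<le> 1"
      proof -
        have "t = t'" if "t \<in> N" "t' \<in> N" for t t' using single v that by (auto simp: N_def)
        moreover have "finite N" using fin(2) by (simp add: N_def)
        ultimately show ?thesis by (simp add: card_le_Suc0_iff_eq)
      qed
      moreover have "Suc (card (C - {v})) = card C" using card_Suc_Diff1 fin(4) v by metis
      ultimately show ?thesis by linarith
    qed
    have "disjnt C C'" using pairwiseD[OF disj C(1,2) \<open>C \<noteq> C'\<close>] .
    then have "card C + card C' = card (C \<union> C')"
      using fin(4) C by (intro card_Un_disjoint[symmetric]) (auto simp: disjnt_def)
    also have "\<dots> \<le> card (\<Union>\<D>)" using fUD C by (intro card_mono) auto
    finally show False using le[OF C(1,3)] le[OF C(2,4)] C(5,6) card_V ST n2 by linarith
  qed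
  define \<D>1 where "\<D>1 = {D \<in> \<D>. \<forall>v\<in>D. degree E v \<noteq> \<Delta>}"
  define \<D>2 where "\<D>2 = \<D> - \<D>1"
  define Q where "Q = (\<Sum>D\<in>\<D>2. card (arcs E D T))"
  have fD12: "finite \<D>1" "finite \<D>2" using fin(3) by (auto simp: \<D>1_def \<D>2_def)
  have "card \<D>2 \<le> 1"
  proof -
    have "C = C'" if "C \<in> \<D>2" "C' \<in> \<D>2" for C C'
      using that D_max unfolding \<D>1_def \<D>2_def by blast
    then show ?thesis using fD12(2) by (simp add: card_le_Suc0_iff_eq)
  qed
  \<comment> \<open>The surplus 2 drops to 1 because the at most one member in \<open>\<D>2\<close>
    contributes 1 to \<open>card \<D>\<close>, while its edges are kept in full as
    \<open>Q\<close>.\<close>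
  have Q: "2 * card S + Q + 1 \<le> 2 * card T"
  proof -
    have "\<D>1 \<subseteq> \<D>" by (auto simp: \<D>1_def)
    then have "(\<Sum>D\<in>\<D>. card (arcs E D T)) = (\<Sum>D\<in>\<D>1. card (arcs E D T)) + Q"
      and "card \<D> = card \<D>1 + card \<D>2"
      using fin(3) sum.subset_diff[of \<D>1 \<D> "\<lambda>D. card (arcs E D T)"] card_Diff_subset[of \<D>1 \<D>] card_mono[of \<D> \<D>1] fD12
      by (auto simp: Q_def \<D>2_def)
    moreover have "(\<Sum>D\<in>\<D>1. 1) \<le> (\<Sum>D\<in>\<D>1. card (arcs E D T))"
      using odd1 by (intro sum_mono) (auto simp: \<D>1_def)
    ultimately show ?thesis using tight edges_D \<open>card \<D>2 \<le> 1\<close> by simp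
  qed
  define w where "w t = 1 / real (degree E t)" for t
  define r where "r u = (\<Sum>t | t \<in> T \<and> {t, u} \<in> E. w t)" for u
  define X where "X = {x \<in> \<Union>\<D>1. \<exists>t\<in>T. {t, x} \<in> E}"
  have fX: "finite X" using fUD by (auto simp: X_def \<D>1_def intro: finite_subset)
  \<comment> \<open>Each \<open>t\<close> distributes a total charge of 1, and \<open>r u\<close> is
    what \<open>u\<close> receives.\<close>
  have card_T: "real (card T) = (\<Sum>u\<in>V. r u)"
  proof -
    have "(\<Sum>u | u \<in> V \<and> {t, u} \<in> E. w t) = 1" if "t \<in> T" for t
      using deg2[of t] that sub(2) by (auto simp: w_def nb[symmetric])
    then have "real (card T) = (\<Sum>t\<in>T. \<Sum>u | u \<in> V \<and> {t, u} \<in> E. w t)" by simp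
    also have "\<dots> = (\<Sum>u\<in>V. r u)" unfolding r_def by (rule sum.swap_restrict[OF fin(2) fV])
    finally show ?thesis .
  qed
  have split: "(\<Sum>u\<in>V. r u) = (\<Sum>u\<in>S. r u) + (\<Sum>u\<in>X. r u) + (\<Sum>u\<in>\<Union>\<D>2. r u)"
  proof -
    have "r u = 0" if "u \<in> V - (S \<union> X \<union> \<Union>\<D>2)" for u
    proof -
      have "{t. t \<in> T \<and> {t, u} \<in> E} = {}" using that into by (auto simp: X_def \<D>2_def)
      then show ?thesis unfolding r_def by (simp only: sum.empty)
    qed
    moreover have "S \<union> X \<union> \<Union>\<D>2 \<subseteq> V" using sub UD by (auto simp: X_def \<D>1_def \<D>2_def)
    ultimately have "(\<Sum>u\<in>V. r u) = (\<Sum>u\<in>S \<union> X \<union> \<Union>\<D>2. r u)" using fV by (intro sum.mono_neutral_right) auto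
    moreover have "S \<inter> X = {}" "(S \<union> X) \<inter> \<Union>\<D>2 = {}"
    proof -
      show "S \<inter> X = {}" using UD by (auto simp: X_def \<D>1_def)
      have "D' \<inter> D'' = {}" if "D' \<in> \<D>1" "D'' \<in> \<D>2" for D' D''
        using that pairwiseD[OF disj, of D' D''] by (auto simp: \<D>1_def \<D>2_def disjnt_def)
      then show "(S \<union> X) \<inter> \<Union>\<D>2 = {}" using UD by (fastforce simp: X_def \<D>2_def)
    qed
    moreover have "finite (\<Union>\<D>2)" using fUD by (auto simp: \<D>2_def intro: finite_subset)
    ultimately show ?thesis using fin(1) fX by (simp add: sum.union_disjoint)
  qed
  have "(\<Sum>u\<in>\<Union>\<D>2. r u) \<le> real Q / 2"
  proof -
    have "r x \<le> real (card {t \<in> T. {x, t} \<in> E}) / 2" for x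
    proof -
      have "r x \<le> (\<Sum>t | t \<in> T \<and> {t, x} \<in> E. 1 / 2)"
        unfolding r_def w_def using deg2 sub(2) by (intro sum_mono) (force simp: field_simps)
      then show ?thesis by (simp add: insert_commute)
    qed
    then have le: "(\<Sum>u\<in>C. r u) \<le> real (card (arcs E C T)) / 2" if "C \<in> \<D>2" for C
      using that fin by (simp add: card_arcs_sum \<D>2_def sum_divide_distrib sum_mono)
    have "(\<Sum>u\<in>\<Union>\<D>2. r u) = (\<Sum>C\<in>\<D>2. \<Sum>u\<in>C. r u)"
      using fin(4) pairwiseD[OF disj] by (intro sum.Union_disjoint[unfolded comp_def]) (auto simp: \<D>2_def disjnt_def)
    also have "\<dots> \<le> (\<Sum>C\<in>\<D>2. real (card (arcs E C T)) / 2)" using le by (rule sum_mono)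
    finally show ?thesis by (simp add: Q_def sum_divide_distrib)
  qed
  moreover have "(\<Sum>u\<in>X. r u) \<le> (\<Sum>s\<in>S. real (card {x \<in> X. {x, s} \<in> E}) / \<Delta>)"
  proof -
    have "r x \<le> real (card {s \<in> S. {x, s} \<in> E}) / \<Delta>" if x: "x \<in> X" for x
    proof -
      obtain C t where C: "C \<in> \<D>" "x \<in> C" "\<forall>v\<in>C. degree E v \<noteq> \<Delta>" and t: "t \<in> T" "{x, t} \<in> E"
        using x by (auto simp: X_def \<D>1_def insert_commute)
      have "{t'. t' \<in> T \<and> {t', x} \<in> E} = {t}" using single C t by (auto simp: insert_commute)
      then have r: "r x = 1 / degree E t" unfolding r_def w_def by simp
      \<comment> \<open>A neighbour of \<open>x\<close> with degree \<Delta> is not in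
        \<open>C\<close>, which has no such vertex, and \<open>t\<close> is the only neighbour of
        \<open>x\<close> in \<open>T\<close>; so it lies in \<open>S\<close>.\<close>
      have "{z. {x, z} \<in> E \<and> z \<noteq> t \<and> degree E z = \<Delta>} \<subseteq> {s \<in> S. {x, s} \<in> E}"
        using closed[OF C(1,2)] C(3) single C(1,2) t by blast
      then have "card {z. {x, z} \<in> E \<and> z \<noteq> t \<and> degree E z = \<Delta>} \<le> card {s \<in> S. {x, s} \<in> E}"
        using fin(1) by (intro card_mono) auto
      then have p: "\<Delta> + 1 \<le> degree E t + card {s \<in> S. {x, s} \<in> E}" using VAL[OF t(2)] by linarith
      have d: "2 \<le> degree E t" "degree E t \<le> \<Delta>" using deg2 deg sub(2) t by auto
      have "real \<Delta> \<le> real (degree E t) * (real \<Delta> + 1 - real (degree E t))"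
      proof -
        \<comment> \<open>With d for the degree of \<open>t\<close>, the product (\<Delta> - d)(d -
          1) equals d(\<Delta> + 1 - d) - \<Delta>.\<close>
        have "0 \<le> (real \<Delta> - degree E t) * (real (degree E t) - 1)" using d by (intro mult_nonneg_nonneg) auto
        then show ?thesis by (simp add: algebra_simps)
      qed
      also have "\<dots> \<le> real (degree E t) * card {s \<in> S. {x, s} \<in> E}"
        using p by (intro mult_left_mono) linarith+
      finally show ?thesis unfolding r using d by (simp add: field_simps)
    qed
    then have "(\<Sum>u\<in>X. r u) \<le> (\<Sum>x\<in>X. \<Sum>s | s \<in> S \<and> {x, s} \<in> E. 1 / \<Delta>)"
      by (intro sum_mono) simp
    also have "\<dots> = (\<Sum>s\<in>S. \<Sum>x | x \<in> X \<and> {x, s} \<in> E. 1 / \<Delta>)" by (rule sum.swap_restrict[OF fX fin(1)])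
    finally show ?thesis by simp
  qed
  moreover have "(\<Sum>s\<in>S. r s) + (\<Sum>s\<in>S. real (card {x \<in> X. {x, s} \<in> E}) / \<Delta>) \<le> (\<Sum>s\<in>S. 1)"
    unfolding sum.distrib[symmetric]
  proof (rule sum_mono)
    fix s assume s: "s \<in> S"
    define NT where "NT = {t \<in> T. {t, s} \<in> E}"
    define NX where "NX = {x \<in> X. {x, s} \<in> E}"
    have fN: "finite NT" "finite NX" using fin(2) fX by (auto simp: NT_def NX_def)
    have XV: "X \<subseteq> V - T" using UD by (auto simp: X_def \<D>1_def)
    have Xd: "degree E x \<noteq> \<Delta>" if "x \<in> X" for x using that by (auto simp: X_def \<D>1_def)
    show "r s + real (card {x \<in> X. {x, s} \<in> E}) / \<Delta> \<le> 1"
    proof (cases "NT = {}")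
      case True
      then have "r s = 0" unfolding r_def NT_def by (simp only: sum.empty)
      moreover have "card NX \<le> degree E s"
        unfolding nb NX_def using XV fV by (intro card_mono) (auto simp: insert_commute)
      then have "card NX \<le> \<Delta>" using deg[of s] by linarith
      ultimately show ?thesis by (simp add: NX_def divide_le_eq)
    next
      case False
      \<comment> \<open>A neighbour of least degree \<open>M\<close> makes every single contribution
        to \<open>s\<close> at most \<open>1 / M\<close>. It then suffices that \<open>s\<close> has
        at most \<open>M\<close> contributors.\<close>
      obtain t where t: "t \<in> NT" and tmin: "\<And>t'. t' \<in> NT \<Longrightarrow> degree E t \<le> degree E t'"
        using ex_has_least_nat[of "\<lambda>t. t \<in> NT" _ "degree E"] False by blast
      define M where "M = degree E t"
      have M: "2 \<le> M" "M \<le> \<Delta>" using deg2 deg t sub(2) by (auto simp: M_def NT_def)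
      define A where "A = {t' \<in> NT. degree E t' \<noteq> \<Delta>}"
      define Z where "Z = {z. {s, z} \<in> E \<and> z \<noteq> t \<and> degree E z = \<Delta>}"
      have Z: "\<Delta> + 1 \<le> M + card Z"
        using VAL[of s t] t by (simp add: M_def Z_def NT_def insert_commute)
      have fZ: "finite Z" "Z \<subseteq> V"
        using simple_graph_edge(3)[OF G] fV by (auto simp: Z_def intro: finite_subset)
      \<comment> \<open>Vertices of \<open>A\<close> and \<open>NX\<close> do not have degree
        \<Delta>, so they are disjoint from \<open>Z\<close>, which has at least
        \<open>\<Delta> + 1 - M\<close> elements. This leaves at most \<open>M - 1\<close> for
        \<open>A\<close> and \<open>NX\<close>.\<close>
      have "card A + card NX + card Z \<le> \<Delta>"
      proof -
        have "A \<inter> NX = {}" "(A \<union> NX) \<inter> Z = {}" using XV Xd by (auto simp: A_def NX_def NT_def Z_def)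
        then have "card A + card NX + card Z = card (A \<union> NX \<union> Z)"
          using fN fZ by (simp add: card_Un_disjoint A_def)
        also have "\<dots> \<le> degree E s"
          unfolding nb using fV fZ(2) XV sub(2)
          by (intro card_mono) (auto simp: A_def NX_def NT_def Z_def insert_commute)
        finally show ?thesis using deg[of s] by linarith
      qed
      then have AX: "card A + card NX + 1 \<le> M" using Z by linarith
      \<comment> \<open>By \<open>T_max\<close> only one vertex of \<open>NT\<close> can have degree
        \<Delta>; it uses up the one place left.\<close>
      have "card NT \<le> card A + 1"
      proof -
        have "card (NT - A) \<le> 1"
        proof -
          have "a = b" if "a \<in> NT - A" "b \<in> NT - A" for a b
            using that T_max by (auto simp: A_def NT_def)
          then show ?thesis using fN(1) by (simp add: card_le_Suc0_iff_eq)
        qed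
        moreover have "card NT = card A + card (NT - A)"
          using fN(1) card_Diff_subset[of A NT] card_mono[of NT A] by (auto simp: A_def)
        ultimately show ?thesis by linarith
      qed
      then have sum: "card NT + card NX \<le> M" using AX by linarith
      have "r s \<le> (\<Sum>t'\<in>NT. 1 / M)"
        unfolding r_def NT_def[symmetric] w_def
      proof (rule sum_mono)
        fix t' assume "t' \<in> NT"
        then have "M \<le> degree E t'" using tmin by (simp add: M_def)
        then show "1 / real (degree E t') \<le> 1 / M" using M by (simp add: frac_le)
      qed
      then have "r s \<le> real (card NT) / M" by simp
      moreover have "real (card NX) / \<Delta> \<le> real (card NX) / M" using M by (simp add: frac_le)
      moreover have "real (card NT) / M + real (card NX) / M \<le> 1"
        using sum M by (simp add: divide_simps)
      ultimately show ?thesis unfolding NX_def by linarith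
    qed
  qed
  ultimately have "real (card T) \<le> real (card S) + real Q / 2" using card_T split by simp
  moreover have "2 * real (card S) + real Q + 1 \<le> 2 * real (card T)" using Q by linarith
  ultimately show False by linarith
qed

end
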